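(* Let $d\in\mathbb{N}$. (i) For every $\alpha\in(0,d/2)$ there is a constant $C\in(0,\infty)$ such that for all $n\in\mathbb{N}$ and all real $\lambda\ge 1$, $$\mathrm{Var}[\tilde{\mathcal O}^{d,\alpha}(\mathcal U_n)]\le C\,n^{1-(2\alpha/d)},\qquad \mathrm{Var}[\tilde{\mathcal O}^{d,\alpha}(\mathcal P_\lambda)]\le C\,\lambda^{1-(2\alpha/d)}.$$ (ii) There is a constant $C\in(0,\infty)$ such that for all $n\in\mathbb{N}$ and all real $\lambda\ge 1$, $$\mathrm{Var}[\tilde{\mathcal O}^{d,d/2}(\mathcal U_n)]\le C\log(1+n),\qquad \mathrm{Var}[\tilde{\mathcal O}^{d,d/2}(\mathcal P_\lambda)]\le C\log(1+\lambda).$$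
   Context: $\mathbb{N}=\{1,2,3,\ldots\}$ and $\|\cdot\|$ is the Euclidean norm on $\mathbb{R}^d$. On a probability space $(\Omega,\mathcal F,\mathbb{P})$ let $\mathbf U_1,\mathbf U_2,\ldots$ be independent uniformly distributed random vectors in $(0,1)^d$, and let $\mathcal U_n:=(\mathbf U_1,\ldots,\mathbf U_n)$. The on-line nearest-neighbour graph on $\mathcal U_n$ joins each $\mathbf U_i$, $2\le i\le n$, by an edge to its Euclidean nearest neighbour among $\mathbf U_1,\ldots,\mathbf U_{i-1}$. For $\mathbf x\in\mathbb{R}^d$ and $\mathcal X\subset\mathbb{R}^d$ let $d(\mathbf x;\mathcal X):=\inf_{\mathbf y\in\mathcal X\setminus\{\mathbf x\}}\|\mathbf x-\mathbf y\|$. For $\alpha>0$ the total power-weighted edge length is $\mathcal O^{d,\alpha}(\mathcal U_n):=\sum_{i=2}^n \big(d(\mathbf U_i;\{\mathbf U_1,\ldots,\mathbf U_{i-1}\})\big)^\alpha$ for $n\ge2$, with $\mathcal O^{d,\alpha}(\mathcal U_1):=0$ and $\mathcal O^{d,\alpha}(\mathcal U_0):=0$ ($\mathcal U_0$ the empty sequence). Let $(N(t);t\ge0)$ be the counting process of a homogeneous Poisson process of unit rate on $(0,\infty)$, independent of $(\mathbf U_1,\mathbf U_2,\ldots)$ (so $N(\lambda)$ is Poisson with mean $\lambda$), and for $\lambda>0$ set $\mathcal P_\lambda:=\mathcal U_{N(\lambda)}$. The centred versions are $\tilde{\mathcal O}^{d,\alpha}(\mathcal U_n):=\mathcal O^{d,\alpha}(\mathcal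 U_n)-\mathbb{E}[\mathcal O^{d,\alpha}(\mathcal U_n)]$ and $\tilde{\mathcal O}^{d,\alpha}(\mathcal P_\lambda):=\mathcal O^{d,\alpha}(\mathcal P_\lambda)-\mathbb{E}[\mathcal O^{d,\alpha}(\mathcal P_\lambda)]$. *)

theory Defs
  imports "HOL-Probability.Probability"
begin

(* The distance from x to X, where x itself is not counted. By the convention of infdist it is 0
   if X - {x} is empty. In the sum below this happens only if the points u 1, ..., u i all
   coincide, which for independent uniform points has probability 0. *)
definition nn_dist :: "real ^ 'd \<Rightarrow> (real ^ 'd) set \<Rightarrow> real" where
  "nn_dist x X = infdist x (X - {x})"

(* Sequences are indexed from 1, as in U_1, U_2, ...; u 0 is irrelevant. The sum is empty for
   n = 0 and n = 1. *)
definition onng_length :: "real \<Rightarrow> (nat \<Rightarrow> real ^ 'd) \<Rightarrow> nat \<Rightarrow> real" where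
  "onng_length \<alpha> u n = (\<Sum>i=2..n. nn_dist (u i) (u ` {1..<i}) powr \<alpha>)"

definition open_unit_cube :: "(real ^ 'd) set" where
  "open_unit_cube = {x. \<forall>i. 0 < x $ i \<and> x $ i < 1}"

(* The increments are truncated differences of natural numbers. Since almost every path is
   nondecreasing, truncation can take effect only on a null set. *)
definition unit_rate_poisson_process :: "'w measure \<Rightarrow> (real \<Rightarrow> 'w \<Rightarrow> nat) \<Rightarrow> bool" where
  "unit_rate_poisson_process M N \<longleftrightarrow>
     (\<forall>t\<ge>0. N t \<in> measurable M (count_space UNIV)) \<and>
     (AE \<omega> in M. N 0 \<omega> = 0 \<and>
        (\<forall>s\<ge>0. \<forall>t\<ge>s. N s \<omega> \<le> N t \<omega>) \<and>
        (\<forall>t\<ge>0. continuous (at_right t) (\<lambda>s. N s \<omega>))) \<and>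
     (\<forall>s\<ge>0. \<forall>t>s. distr M (count_space UNIV) (\<lambda>\<omega>. N t \<omega> - N s \<omega>)
                   = measure_pmf (poisson_pmf (t - s))) \<and>
     (\<forall>(t :: nat \<Rightarrow> real) k. 0 \<le> t 0 \<and> mono t \<longrightarrow>
        prob_space.indep_vars M (\<lambda>_. count_space UNIV)
          (\<lambda>j \<omega>. N (t (Suc j)) \<omega> - N (t j) \<omega>) {..<k})"

(* This is indep_var, except that X and Y may have values in different types. *)
definition indep_rvs ::
    "'w measure \<Rightarrow> 'a measure \<Rightarrow> ('w \<Rightarrow> 'a) \<Rightarrow> 'b measure \<Rightarrow> ('w \<Rightarrow> 'b) \<Rightarrow> bool" where
  "indep_rvs M A X B Y \<longleftrightarrow>
     X \<in> measurable M A \<and> Y \<in> measurable M B \<and>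
     prob_space.indep_set M {X -` S \<inter> space M | S. S \<in> sets A} {Y -` S \<inter> space M | S. S \<in> sets B}"

definition centred :: "'w measure \<Rightarrow> ('w \<Rightarrow> real) \<Rightarrow> 'w \<Rightarrow> real" where
  "centred M X = (\<lambda>\<omega>. X \<omega> - integral\<^sup>L M X)"

(* The library's variance is a Bochner integral, which is 0 for a non-integrable function. An upper
   bound on it is meaningful only together with square integrability. *)
definition variance_le :: "'w measure \<Rightarrow> ('w \<Rightarrow> real) \<Rightarrow> real \<Rightarrow> bool" where
  "variance_le M X c \<longleftrightarrow>
     X \<in> borel_measurable M \<and> integrable M (\<lambda>\<omega>. (X \<omega>)\<^sup>2) \<and> prob_space.variance M X \<le> c"

end

theory Submission
  imports Defs "HOL-Real_Asymp.Real_Asymp"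
begin

text \<open>
  Write \<open>s = \<alpha> / d \<le> 1/2\<close>. The \<open>j\<close>-th point has its nearest neighbour at a distance of order
  \<open>j powr (-1/d)\<close>, so its edge has weight of order \<open>j powr (-s)\<close>. If the edge weights were
  uncorrelated, the variance would be of order \<open>\<Sum>i\<le>n. i powr (-2 * s)\<close>, and this is the bound claimed:
  \<open>n powr (1 - 2 * s)\<close> for \<open>s < 1/2\<close> and \<open>ln n\<close> for \<open>s = 1/2\<close>. The task is to control the
  correlations without losing a logarithm in the second case.

  The Doob decomposition splits the length into a martingale and its compensator. The increments of
  the martingale are orthogonal and bounded in \<open>L\<^sup>2\<close> by the edge weights, which gives the sum above
  (\<open>expectation_compensated_power2_le\<close>). The compensator is the sum over \<open>j\<close> of
  \<open>mean_gap \<alpha> {1..j} u\<close>, the integral over the cube of the \<open>\<alpha>\<close>-th power of the distance to the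
  first \<open>j\<close> points. Such an integral depends little on each point: adding one point affects only a
  region of volume of order \<open>1 / j\<close>, and the change has \<open>L\<^sup>2\<close> norm of order \<open>j powr (-1 - s)\<close>
  (\<open>expectation_mean_gap_insert_diff_power2_le\<close>). Hence omitting the point \<open>i\<close> changes the compensator,
  in \<open>L\<^sup>2\<close> norm, by at most the sum of these over \<open>j \<ge> i\<close>, which is of order \<open>i powr (-s)\<close>, and the
  Efron--Stein inequality (\<open>efron_stein\<close>) gives the same sum again. It is essential to apply
  Efron--Stein to the sum as a whole: the triangle inequality applied to the standard deviations of
  the summands, of order \<open>j powr (-1/2 - s)\<close>, would give \<open>(ln n)\<^sup>2\<close> for \<open>s = 1/2\<close>.

  All estimates of distances come from one tail bound: a ball of radius \<open>r\<close> around a point of the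
  cube contains at least a fixed fraction of \<open>r ^ d\<close> of the volume of the cube
  (\<open>emeasure_far_from_point_le\<close>), so that it is free of \<open>j\<close> independent points with probability at
  most \<open>exp (- c * j * r ^ d)\<close>.

  For a Poisson number of points, the variance splits into the mean of the conditional variance and
  the variance of the conditional mean. The former is controlled by concavity of the bound in the
  number of points; for the latter, the mean length changes by \<open>O(l powr (-s))\<close> per point
  (\<open>mean_length_lipschitz\<close>) and the number of points has variance \<open>l\<close>.
\<close>

section \<open>Variance and the Efron--Stein inequality\<close>

lemma (in prob_space) integrable_bounded:
  fixes f :: "'a \<Rightarrow> real"
  assumes "f \<in> borel_measurable M" "\<And>x. \<bar>f x\<bar> \<le> B"
  shows "integrable M f"
  by (rule integrable_const_bound[where B = B]) (use assms in auto)

lemma (in prob_space) abs_expectation_le: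
  fixes f :: "'a \<Rightarrow> real"
  assumes "f \<in> borel_measurable M" "\<And>x. \<bar>f x\<bar> \<le> B"
  shows "\<bar>expectation f\<bar> \<le> B"
proof -
  have "0 \<le> B" using assms(2)[of undefined] by linarith
  have "\<bar>expectation f\<bar> \<le> (\<integral>x. \<bar>f x\<bar> \<partial>M)"
    by (rule integral_abs_bound)
  also have "\<dots> \<le> (\<integral>x. B \<partial>M)"
    using assms \<open>0 \<le> B\<close> by (intro integral_mono integrable_bounded[where B = B]) auto
  finally show ?thesis by (simp add: prob_space)
qed

lemma (in prob_space) expectation_power2_le:
  fixes f :: "'a \<Rightarrow> real"
  assumes "integrable M f" "integrable M (\<lambda>x. (f x)\<^sup>2)"
  shows "(expectation f)\<^sup>2 \<le> expectation (\<lambda>x. (f x)\<^sup>2)"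
  using variance_eq[OF assms] variance_positive[of f] by simp

lemma (in prob_space) variance_le_expectation_diff_power2:
  fixes f :: "'a \<Rightarrow> real"
  assumes "integrable M f" "integrable M (\<lambda>x. (f x)\<^sup>2)"
  shows "variance f \<le> expectation (\<lambda>x. (f x - c)\<^sup>2)"
proof -
  have "expectation (\<lambda>x. (f x - c)\<^sup>2) = expectation (\<lambda>x. (f x)\<^sup>2) - 2 * c * expectation f + c\<^sup>2"
    using assms by (simp add: power2_diff prob_space)
  moreover have "0 \<le> (expectation f - c)\<^sup>2" by simp
  ultimately show ?thesis
    unfolding variance_eq[OF assms] by (simp add: power2_diff algebra_simps)
qed

lemma abs_power2_le:
  fixes a B :: real
  assumes "\<bar>a\<bar> \<le> B"
  shows "\<bar>a\<^sup>2\<bar> \<le> B\<^sup>2"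
  using assms power_mono[of "\<bar>a\<bar>" B 2] by simp

lemma power2_add_le: "(x + y)\<^sup>2 \<le> 2 * x\<^sup>2 + 2 * y\<^sup>2" for x y :: real
  using zero_le_power2[of "x - y"] unfolding power2_sum power2_diff by linarith

text \<open>Efron--Stein, in the form of a telescoping over coordinates: integrating out the coordinate
  \<open>k\<close> splits the variance into the mean conditional variance given the other coordinates, which
  any \<open>g k\<close> not depending on that coordinate bounds from above, and the variance of the averaged
  function. Averaging over \<open>k\<close> does not increase the mean square distance to the other \<open>g i\<close>,
  by Jensen's inequality, so induction applies.\<close>

lemma efron_stein:
  fixes M :: "'i \<Rightarrow> 'a measure" and f :: "('i \<Rightarrow> 'a) \<Rightarrow> real" and g :: "'i \<Rightarrow> ('i \<Rightarrow> 'a) \<Rightarrow> real"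
  assumes prob: "\<And>i. prob_space (M i)" and "finite I"
    and "f \<in> borel_measurable (Pi\<^sub>M I M)" "\<And>x. \<bar>f x\<bar> \<le> B"
    and "\<And>i. i \<in> I \<Longrightarrow> g i \<in> borel_measurable (Pi\<^sub>M I M)"
    and "\<And>i x. i \<in> I \<Longrightarrow> \<bar>g i x\<bar> \<le> B"
    and "\<And>i x y. i \<in> I \<Longrightarrow> g i (x(i := y)) = g i x"
  shows "(\<integral>x. (f x)\<^sup>2 \<partial>Pi\<^sub>M I M) - (\<integral>x. f x \<partial>Pi\<^sub>M I M)\<^sup>2
           \<le> (\<Sum>i\<in>I. \<integral>x. (f x - g i x)\<^sup>2 \<partial>Pi\<^sub>M I M)"
  using assms(2-)
proof (induction I arbitrary: f g rule: finite_induct)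
  case empty
  have "Pi\<^sub>M {} M = count_space {\<lambda>x. undefined}"
    by (rule PiM_empty)
  then show ?case by (simp add: lebesgue_integral_count_space_finite)
next
  case (insert k I)
  let ?P = "Pi\<^sub>M I M" and ?P' = "Pi\<^sub>M (insert k I) M"
  interpret M: prob_space "M i" for i by (rule prob)
  interpret product_sigma_finite M by standard
  interpret P: prob_space ?P by (rule prob_space_PiM) (rule prob)
  interpret P': prob_space ?P' by (rule prob_space_PiM) (rule prob)
  note f = insert.prems(1,2) and g = insert.prems(3,4,5)
  define avg where "avg h x = (\<integral>y. h (x(k := y)) \<partial>M k)" for h :: "('i \<Rightarrow> 'a) \<Rightarrow> real" and x
  have joint: "(\<lambda>(x, y). h (x(k := y))) \<in> borel_measurable (?P \<Otimes>\<^sub>M M k)"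
    if "h \<in> borel_measurable ?P'" for h :: "('i \<Rightarrow> 'a) \<Rightarrow> real"
    using measurable_compose[OF measurable_add_dim that] by (simp add: split_beta')
  have sect: "(\<lambda>y. h (x(k := y))) \<in> borel_measurable (M k)"
    if "h \<in> borel_measurable ?P'" "x \<in> space ?P" for h :: "('i \<Rightarrow> 'a) \<Rightarrow> real" and x
    using measurable_Pair2[OF joint[OF that(1)] that(2)] by simp
  have avg_meas: "avg h \<in> borel_measurable ?P" if "h \<in> borel_measurable ?P'" for h
    unfolding avg_def using M.borel_measurable_lebesgue_integral[OF joint[OF that]]
    by simp
  have avg_bound: "\<bar>avg h x\<bar> \<le> b"
    if "h \<in> borel_measurable ?P'" "\<And>x. \<bar>h x\<bar> \<le> b" for h b x
  proof (cases "(\<lambda>y. h (x(k := y))) \<in> borel_measurable (M k)")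
    case True
    then show ?thesis unfolding avg_def using that by (intro M.abs_expectation_le) auto
  next
    case False
    then have "avg h x = 0" unfolding avg_def
      using not_integrable_integral_eq borel_measurable_integrable by blast
    moreover have "0 \<le> b" using that(2)[of x] by linarith
    ultimately show ?thesis by simp
  qed
  have fubini: "(\<integral>x. h x \<partial>?P') = (\<integral>x. avg h x \<partial>?P)"
    if "h \<in> borel_measurable ?P'" "\<And>x. \<bar>h x\<bar> \<le> b" for h b
    unfolding avg_def using that insert.hyps
    by (intro product_integral_insert P'.integrable_bounded[where B = b]) auto
  have sq: "\<bar>(f x)\<^sup>2\<bar> \<le> B\<^sup>2" for x using abs_power2_le[OF f(2)] .
  have diff: "\<bar>(f x - g i x)\<^sup>2\<bar> \<le> (2 * B)\<^sup>2" if "i \<in> insert k I" for x i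
    using f(2)[of x] g(2)[OF that, of x] by (intro abs_power2_le) linarith
  define F G where "F = avg f" and "G i = avg (g i)" for i
  have F: "F \<in> borel_measurable ?P" "\<bar>F x\<bar> \<le> B" for x
    unfolding F_def using avg_meas[OF f(1)] avg_bound[OF f] by auto
  have G: "G i \<in> borel_measurable ?P" "\<bar>G i x\<bar> \<le> B" "G i (x(i := y)) = G i x"
    if "i \<in> I" for i x y
  proof -
    show "G i \<in> borel_measurable ?P" "\<bar>G i x\<bar> \<le> B"
      unfolding G_def using that g by (auto intro!: avg_meas avg_bound)
    have "k \<noteq> i" using that insert.hyps by auto
    then have "g i (x(i := y, k := z)) = g i (x(k := z))" for z
      by (metis fun_upd_twist g(3) insertI2 that)
    then show "G i (x(i := y)) = G i x"
      unfolding G_def avg_def by simp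
  qed
  have IH: "(\<integral>x. (F x)\<^sup>2 \<partial>?P) - (\<integral>x. F x \<partial>?P)\<^sup>2 \<le> (\<Sum>i\<in>I. \<integral>x. (F x - G i x)\<^sup>2 \<partial>?P)"
    by (rule insert.IH) (fact F G)+
  have f2m: "(\<lambda>x. (f x)\<^sup>2) \<in> borel_measurable ?P'" using f(1) by simp
  have fgm: "(\<lambda>x. (f x - g i x)\<^sup>2) \<in> borel_measurable ?P'" if "i \<in> insert k I" for i
    using f(1) g(1)[OF that] by simp
  have F2: "\<bar>(F x)\<^sup>2\<bar> \<le> B\<^sup>2" for x using abs_power2_le[OF F(2)] .
  have "(\<integral>x. (f x)\<^sup>2 \<partial>?P') - (\<integral>x. (F x)\<^sup>2 \<partial>?P)
      = (\<integral>x. avg (\<lambda>x. (f x)\<^sup>2) x - (F x)\<^sup>2 \<partial>?P)"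
    using F F2 avg_meas[OF f2m] avg_bound[OF f2m sq]
    by (subst fubini[OF f2m sq], subst Bochner_Integration.integral_diff)
       (auto intro!: P.integrable_bounded[where B = "B\<^sup>2"])
  also have "\<dots> \<le> (\<integral>x. avg (\<lambda>x. (f x - g k x)\<^sup>2) x \<partial>?P)"
  proof (rule integral_mono)
    show "integrable ?P (\<lambda>x. avg (\<lambda>x. (f x)\<^sup>2) x - (F x)\<^sup>2)"
      using F F2 avg_meas[OF f2m] avg_bound[OF f2m sq]
      by (intro Bochner_Integration.integrable_diff P.integrable_bounded[where B = "B\<^sup>2"]) auto
    show "integrable ?P (avg (\<lambda>x. (f x - g k x)\<^sup>2))"
      using avg_meas[OF fgm[OF insertI1]] avg_bound[OF fgm[OF insertI1] diff[OF insertI1]]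
      by (intro P.integrable_bounded) auto
    fix x assume x: "x \<in> space ?P"
    have m: "(\<lambda>y. f (x(k := y))) \<in> borel_measurable (M k)" by (rule sect[OF f(1) x])
    have "M.variance k (\<lambda>y. f (x(k := y))) \<le> M.expectation k (\<lambda>y. (f (x(k := y)) - g k x)\<^sup>2)"
      using m f(2) abs_power2_le[OF f(2)]
      by (intro M.variance_le_expectation_diff_power2 M.integrable_bounded[where B = B]
          M.integrable_bounded[where B = "B\<^sup>2"]) auto
    moreover have "M.variance k (\<lambda>y. f (x(k := y))) = avg (\<lambda>x. (f x)\<^sup>2) x - (F x)\<^sup>2"
      unfolding avg_def F_def using m f(2) abs_power2_le[OF f(2)]
      by (intro M.variance_eq M.integrable_bounded[where B = B]
          M.integrable_bounded[where B = "B\<^sup>2"]) auto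
    ultimately show "avg (\<lambda>x. (f x)\<^sup>2) x - (F x)\<^sup>2 \<le> avg (\<lambda>x. (f x - g k x)\<^sup>2) x"
      unfolding avg_def by (simp only: g(3)[OF insertI1])
  qed
  also have "\<dots> = (\<integral>x. (f x - g k x)\<^sup>2 \<partial>?P')"
    by (rule fubini[symmetric, OF fgm[OF insertI1] diff[OF insertI1]])
  finally have first: "(\<integral>x. (f x)\<^sup>2 \<partial>?P') - (\<integral>x. (F x)\<^sup>2 \<partial>?P) \<le> (\<integral>x. (f x - g k x)\<^sup>2 \<partial>?P')" .
  have second: "(\<integral>x. (F x - G i x)\<^sup>2 \<partial>?P) \<le> (\<integral>x. (f x - g i x)\<^sup>2 \<partial>?P')" if i: "i \<in> I" for i
  proof -
    have FG: "\<bar>(F x - G i x)\<^sup>2\<bar> \<le> (2 * B)\<^sup>2" for x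
      using F(2)[of x] G(2)[OF i, of x] by (intro abs_power2_le) linarith
    have i': "i \<in> insert k I" using i by simp
    have "(\<integral>x. (F x - G i x)\<^sup>2 \<partial>?P) \<le> (\<integral>x. avg (\<lambda>x. (f x - g i x)\<^sup>2) x \<partial>?P)"
    proof (rule integral_mono)
      show "integrable ?P (\<lambda>x. (F x - G i x)\<^sup>2)"
        using F(1) G(1)[OF i] FG by (intro P.integrable_bounded) auto
      show "integrable ?P (avg (\<lambda>x. (f x - g i x)\<^sup>2))"
        using avg_meas[OF fgm[OF i']] avg_bound[OF fgm[OF i'] diff[OF i']]
        by (intro P.integrable_bounded) auto
      fix x assume x: "x \<in> space ?P"
      have mf: "(\<lambda>y. f (x(k := y))) \<in> borel_measurable (M k)" by (rule sect[OF f(1) x])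
      have mg: "(\<lambda>y. g i (x(k := y))) \<in> borel_measurable (M k)" by (rule sect[OF g(1)[OF i'] x])
      have "F x - G i x = M.expectation k (\<lambda>y. f (x(k := y)) - g i (x(k := y)))"
        unfolding F_def G_def avg_def using mf mg f(2) g(2)[OF i']
        by (intro Bochner_Integration.integral_diff[symmetric] M.integrable_bounded[where B = B]) auto
      moreover have "(M.expectation k (\<lambda>y. f (x(k := y)) - g i (x(k := y))))\<^sup>2
          \<le> M.expectation k (\<lambda>y. (f (x(k := y)) - g i (x(k := y)))\<^sup>2)"
        using mf mg f(2) g(2)[OF i'] diff[OF i']
        by (intro M.expectation_power2_le Bochner_Integration.integrable_diff
            M.integrable_bounded[where B = B] M.integrable_bounded[where B = "(2 * B)\<^sup>2"]) auto
      ultimately show "(F x - G i x)\<^sup>2 \<le> avg (\<lambda>x. (f x - g i x)\<^sup>2) x"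
        by (simp add: avg_def)
    qed
    also have "\<dots> = (\<integral>x. (f x - g i x)\<^sup>2 \<partial>?P')"
      by (rule fubini[symmetric, OF fgm[OF i'] diff[OF i']])
    finally show ?thesis .
  qed
  have "(\<integral>x. (f x)\<^sup>2 \<partial>?P') - (\<integral>x. f x \<partial>?P')\<^sup>2
      = ((\<integral>x. (f x)\<^sup>2 \<partial>?P') - (\<integral>x. (F x)\<^sup>2 \<partial>?P)) + ((\<integral>x. (F x)\<^sup>2 \<partial>?P) - (\<integral>x. F x \<partial>?P)\<^sup>2)"
    using fubini[OF f] by (simp add: F_def)
  also have "\<dots> \<le> (\<integral>x. (f x - g k x)\<^sup>2 \<partial>?P') + (\<Sum>i\<in>I. \<integral>x. (f x - g i x)\<^sup>2 \<partial>?P')"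
    by (intro add_mono first order.trans[OF IH] sum_mono second)
  finally show ?case using insert.hyps by simp
qed

section \<open>Uniform points in the cube\<close>

definition unit_cube_measure :: "(real ^ 'd) measure" where
  "unit_cube_measure = uniform_measure lborel open_unit_cube"

lemma open_unit_cube_eq_box: "open_unit_cube = box 0 (1 :: real ^ 'd)"
  by (auto simp: open_unit_cube_def mem_box_cart)

lemma open_unit_cube_in_borel [measurable]: "(open_unit_cube :: (real ^ 'd) set) \<in> sets borel"
  by (simp add: open_unit_cube_eq_box)

lemma emeasure_lborel_box_cart:
  fixes l u :: "real ^ 'd"
  assumes "\<And>i. l $ i \<le> u $ i"
  shows "emeasure lborel (box l u) = ennreal (\<Prod>i\<in>UNIV. u $ i - l $ i)"
proof -
  have "cbox l u \<noteq> {}" using assms by (auto simp: interval_cbox_cart[symmetric] less_eq_vec_def)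
  then have "emeasure lborel (cbox l u) = ennreal (\<Prod>i\<in>UNIV. u $ i - l $ i)"
    using content_cbox_cart[of l u] emeasure_eq_ennreal_measure[of lborel "cbox l u"]
      emeasure_lborel_cbox_finite[of l u] by simp
  moreover have "emeasure lborel (box l u) = emeasure lborel (cbox l u)"
    by (simp add: emeasure_lborel_box_eq emeasure_lborel_cbox_eq)
  ultimately show ?thesis by simp
qed

lemma emeasure_open_unit_cube: "emeasure lborel (open_unit_cube :: (real ^ 'd) set) = 1"
  unfolding open_unit_cube_eq_box by (subst emeasure_lborel_box_cart) auto

lemma sets_unit_cube_measure [simp, measurable_cong]: "sets unit_cube_measure = sets borel"
  by (simp add: unit_cube_measure_def)

lemma space_unit_cube_measure [simp]: "space unit_cube_measure = UNIV"
  by (simp add: unit_cube_measure_def)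

lemma prob_space_unit_cube_measure: "prob_space (unit_cube_measure :: (real ^ 'd) measure)"
  unfolding unit_cube_measure_def
  by (rule prob_space_uniform_measure) (simp_all add: emeasure_open_unit_cube)

lemma emeasure_unit_cube_measure:
  fixes A :: "(real ^ 'd) set"
  assumes "A \<in> sets borel"
  shows "emeasure unit_cube_measure A = emeasure lborel (open_unit_cube \<inter> A)"
  unfolding unit_cube_measure_def using assms
  by (subst emeasure_uniform_measure) (auto simp: emeasure_open_unit_cube divide_ennreal_def)

lemma AE_unit_cube_measure: "AE x in unit_cube_measure. x \<in> open_unit_cube"
  unfolding unit_cube_measure_def by (rule AE_uniform_measureI) auto

lemma AE_unit_cube_measure_neq: "AE x in unit_cube_measure. x \<noteq> c"
  unfolding unit_cube_measure_def
  by (rule AE_uniform_measureI) (use AE_lborel_singleton[of c] in \<open>auto elim: eventually_mono\<close>)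

lemma dist_cart_le_sqrt:
  fixes x y :: "real ^ 'd"
  assumes "\<And>i. \<bar>x $ i - y $ i\<bar> \<le> r"
  shows "dist x y \<le> r * sqrt (real CARD('d))"
proof -
  have r: "0 \<le> r" using assms[of undefined] by (meson abs_ge_zero order_trans)
  have "dist x y = sqrt (\<Sum>i\<in>UNIV. (x $ i - y $ i)\<^sup>2)"
    by (simp add: dist_vec_def L2_set_def dist_real_def)
  also have "\<dots> \<le> sqrt (\<Sum>i\<in>(UNIV::'d set). r\<^sup>2)"
    using assms by (intro real_sqrt_le_mono sum_mono) (metis abs_le_square_iff abs_of_nonneg r)
  also have "\<dots> = r * sqrt (real CARD('d))" using r by (simp add: real_sqrt_mult)
  finally show ?thesis .
qed

lemma dist_open_unit_cube_le:
  fixes x y :: "real ^ 'd"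
  assumes "x \<in> open_unit_cube" "y \<in> open_unit_cube"
  shows "dist x y \<le> sqrt (real CARD('d))"
proof -
  have "\<bar>x $ i - y $ i\<bar> \<le> 1" for i
  proof -
    have "0 < x $ i" "x $ i < 1" "0 < y $ i" "y $ i < 1"
      using assms by (simp_all add: open_unit_cube_def)
    then show ?thesis by linarith
  qed
  from dist_cart_le_sqrt[OF this] show ?thesis by simp
qed

text \<open>The copy of the cube contracted by \<open>t\<close> towards \<open>y\<close> lies in the cube, within distance
  \<open>t * sqrt d\<close> of \<open>y\<close>, wherever \<open>y\<close> is; so the boundary of the cube needs no separate treatment.\<close>

lemma emeasure_far_from_point_le:
  fixes y :: "real ^ 'd"
  assumes y: "y \<in> open_unit_cube" and r: "0 \<le> r"
  shows "emeasure unit_cube_measure {x. r \<le> dist y x}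
           \<le> ennreal (exp (- ((r / sqrt (real CARD('d))) ^ CARD('d))))"
proof -
  let ?D = "sqrt (real CARD('d))"
  define t where "t = r / ?D"
  have D: "0 < ?D" by simp
  have t0: "0 \<le> t" using r D by (simp add: t_def)
  have rt: "r = t * ?D" by (simp add: t_def)
  interpret Q: prob_space "unit_cube_measure :: (real ^ 'd) measure"
    by (rule prob_space_unit_cube_measure)
  have meas: "{x. r \<le> dist y x} \<in> sets (unit_cube_measure :: (real ^ 'd) measure)" by simp
  show ?thesis
  proof (cases "t \<le> 1")
    case True
    define B where "B = box ((1 - t) *\<^sub>R y) ((1 - t) *\<^sub>R y + t *\<^sub>R 1)"
    have ycomp: "0 < y $ i" "y $ i < 1" for i using y by (auto simp: open_unit_cube_def)
    have near: "\<bar>x $ i - y $ i\<bar> \<le> t" if "x \<in> B" for x i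
    proof -
      have "(1 - t) * y $ i < x $ i" "x $ i < (1 - t) * y $ i + t"
        using that by (auto simp: B_def mem_box_cart)
      moreover have "0 \<le> t * y $ i" "t * y $ i \<le> t"
        using ycomp[of i] t0 by (simp_all add: mult_left_le less_imp_le)
      ultimately show ?thesis unfolding abs_le_iff left_diff_distrib by linarith
    qed
    have B_sub: "B \<subseteq> open_unit_cube"
    proof
      fix x assume "x \<in> B"
      then have x: "(1 - t) * y $ i < x $ i" "x $ i < (1 - t) * y $ i + t" for i
        by (auto simp: B_def mem_box_cart)
      have "0 \<le> (1 - t) * y $ i" "(1 - t) * y $ i \<le> 1 - t" for i
        using ycomp[of i] True less_imp_le[OF ycomp(2)[of i]] by (auto intro: mult_left_le)
      with x show "x \<in> open_unit_cube"
        unfolding open_unit_cube_def by (auto intro: le_less_trans) (smt (verit))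
    qed
    have B_borel: "B \<in> sets borel" by (simp add: B_def)
    have "emeasure unit_cube_measure B = ennreal (t ^ CARD('d))"
      using B_sub t0 unfolding emeasure_unit_cube_measure[OF B_borel] Int_absorb1[OF B_sub]
      by (simp add: B_def emeasure_lborel_box_cart)
    then have mB: "Q.prob B = t ^ CARD('d)"
      using t0 by (simp add: measure_def)
    have AEB: "AE x in unit_cube_measure. r \<le> dist y x \<longrightarrow> x \<in> - B"
    proof -
      let ?S = "{x. dist y x = r}"
      have "emeasure lborel (B \<inter> ?S) = 0"
      proof -
        have "B \<inter> ?S \<subseteq> sphere y r" by auto
        moreover have "emeasure lborel (sphere y r) = 0"
          using negligible_sphere[of y r]
          by (simp add: negligible_iff_null_sets null_sets_def)
        ultimately show ?thesis
          by (metis emeasure_mono le_zero_eq sets_lborel borel_closed closed_sphere)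
      qed
      then have "AE x in lborel. x \<notin> B \<inter> ?S"
        by (intro AE_not_in) (auto simp: null_sets_def B_borel)
      then have "AE x in unit_cube_measure. x \<notin> B \<inter> ?S"
        unfolding unit_cube_measure_def
        by (intro AE_uniform_measureI) (auto elim: eventually_mono)
      then show ?thesis
      proof (rule eventually_mono)
        fix x assume x: "x \<notin> B \<inter> ?S"
        show "r \<le> dist y x \<longrightarrow> x \<in> - B"
        proof
          assume le: "r \<le> dist y x"
          show "x \<in> - B"
          proof
            assume "x \<in> B"
            then have "dist x y \<le> r" unfolding rt using near by (intro dist_cart_le_sqrt) auto
            with le x \<open>x \<in> B\<close> show False by (auto simp: dist_commute)
          qed
        qed
      qed
    qed
    have "Q.prob {x. r \<le> dist y x} \<le> Q.prob (- B)"
      using AEB B_borel by (intro Q.finite_measure_mono_AE) (auto simp: Compl_eq_Diff_UNIV)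
    also have "\<dots> = 1 - t ^ CARD('d)"
      using Q.prob_compl[of B] B_borel mB by (simp add: Compl_eq_Diff_UNIV)
    also have "\<dots> \<le> exp (- (t ^ CARD('d)))"
      using exp_ge_add_one_self[of "- (t ^ CARD('d))"] by simp
    finally show ?thesis by (simp add: Q.emeasure_eq_measure t_def ennreal_leI)
  next
    case False
    have "AE x in unit_cube_measure. x \<notin> {x. r \<le> dist y x}"
      using AE_unit_cube_measure
    proof (rule eventually_mono)
      fix x :: "real ^ 'd" assume "x \<in> open_unit_cube"
      then have "dist y x \<le> ?D" using dist_open_unit_cube_le[OF y] by blast
      moreover have "?D < r" using False D by (simp add: t_def)
      ultimately show "x \<notin> {x. r \<le> dist y x}" by simp
    qed
    then have "emeasure unit_cube_measure {x. r \<le> dist y x} = 0"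
      using meas by (simp add: AE_iff_measurable[OF _ refl])
    then show ?thesis by simp
  qed
qed

section \<open>Moments of the distance to the nearest point\<close>

abbreviation cube_points :: "'i set \<Rightarrow> ('i \<Rightarrow> real ^ 'd) measure" where
  "cube_points I \<equiv> Pi\<^sub>M I (\<lambda>_. unit_cube_measure)"

lemma prob_space_cube_points: "prob_space (cube_points I)"
  by (rule prob_space_PiM) (rule prob_space_unit_cube_measure)

text \<open>The distance from \<open>y\<close> to the nearest of the points \<open>u k\<close>, capped at the diameter of the cube.
  The cap makes \<open>gap\<close> bounded on the whole space and gives a sensible value for \<open>J = {}\<close>.\<close>

definition gap :: "'i set \<Rightarrow> ('i \<Rightarrow> real ^ 'd) \<Rightarrow> real ^ 'd \<Rightarrow> real" where
  "gap J u y = Min (insert (sqrt (real CARD('d))) ((\<lambda>k. dist y (u k)) ` J))"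

lemma gap_empty [simp]: "gap {} u (y :: real ^ 'd) = sqrt (real CARD('d))"
  by (simp add: gap_def)

lemma gap_insert: "finite J \<Longrightarrow> gap (insert k J) u y = min (dist y (u k)) (gap J u y)"
  by (simp add: gap_def insert_commute[of _ "dist y (u k)"])

lemma le_gap_iff:
  fixes y :: "real ^ 'd"
  shows "finite J \<Longrightarrow> r \<le> gap J u y \<longleftrightarrow> r \<le> sqrt (real CARD('d)) \<and> (\<forall>k\<in>J. r \<le> dist y (u k))"
  by (simp add: gap_def)

lemma gap_nonneg: "finite J \<Longrightarrow> 0 \<le> gap J u y"
  by (simp add: le_gap_iff)

lemma gap_le_sqrt: "finite J \<Longrightarrow> gap J u (y :: real ^ 'd) \<le> sqrt (real CARD('d))"
  by (simp add: gap_def)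

lemma gap_cong: "(\<And>k. k \<in> J \<Longrightarrow> u k = v k) \<Longrightarrow> gap J u y = gap J v y"
  unfolding gap_def by (rule arg_cong[where f = Min]) auto

lemma gap_powr_le_powr:
  fixes y :: "real ^ 'd"
  assumes "finite J" "0 \<le> \<alpha>"
  shows "gap J u y powr \<alpha> \<le> sqrt (real CARD('d)) powr \<alpha>"
  using assms by (intro powr_mono2 gap_nonneg gap_le_sqrt)

lemma borel_measurable_gap [measurable (raw)]:
  assumes "finite J" "\<And>k. k \<in> J \<Longrightarrow> (\<lambda>x. u x k) \<in> borel_measurable X" "g \<in> borel_measurable X"
  shows "(\<lambda>x. gap J (u x) (g x)) \<in> borel_measurable X"
  using assms(1,2)
proof (induction J rule: finite_induct)
  case (insert k J)
  then show ?case using assms(3) by (simp add: gap_insert)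
qed simp

text \<open>The points of \<open>J\<close> avoid a ball independently of each other and of the remaining points. Radii
  above the cap contribute nothing, so the exponent \<open>card J\<close> may be increased to \<open>card J + 1\<close> at
  the price of a factor \<open>exp 1\<close>; the case \<open>J = {}\<close> is then no exception.\<close>

lemma nn_integral_gap_tail_le:
  fixes y :: "real ^ 'd" and f :: "'i \<Rightarrow> real ^ 'd \<Rightarrow> ennreal"
  assumes I: "finite I" "J \<subseteq> I" and y: "y \<in> open_unit_cube" and r: "0 \<le> r"
    and f: "\<And>k. k \<in> I - J \<Longrightarrow> f k \<in> borel_measurable borel"
  shows "(\<integral>\<^sup>+u. (\<Prod>k\<in>I - J. f k (u k)) * indicator {u. r \<le> gap J u y} u \<partial>cube_points I)
    \<le> (\<Prod>k\<in>I - J. \<integral>\<^sup>+x. f k x \<partial>unit_cube_measure)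
        * ennreal (exp (1 - real (card J + 1) * (r / sqrt (real CARD('d))) ^ CARD('d)))"
proof -
  let ?D = "sqrt (real CARD('d))"
  let ?t = "(r / ?D) ^ CARD('d)"
  have J: "finite J" using I finite_subset by auto
  interpret Q: prob_space "unit_cube_measure :: (real ^ 'd) measure"
    by (rule prob_space_unit_cube_measure)
  interpret product_sigma_finite "\<lambda>_ :: 'i. unit_cube_measure :: (real ^ 'd) measure"
    by standard
  show ?thesis
  proof (cases "r \<le> ?D")
    case False
    then have "indicator {u. r \<le> gap J u y} u = (0 :: ennreal)" for u
      using J by (simp add: le_gap_iff)
    then show ?thesis by simp
  next
    case True
    define \<phi> where "\<phi> k = (if k \<in> J then indicator {x. r \<le> dist y x} else f k)" for k
    have \<phi>: "\<phi> k \<in> borel_measurable unit_cube_measure" if "k \<in> I" for k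
      using f[of k] that by (auto simp: \<phi>_def)
    have split: "(\<Prod>k\<in>I. c k) = (\<Prod>k\<in>I - J. c k) * (\<Prod>k\<in>J. c k)" for c :: "'i \<Rightarrow> ennreal"
      by (rule prod.subset_diff[OF I(2,1)])
    have ind: "indicator {u. r \<le> gap J u y} u = (\<Prod>k\<in>J. indicator {x. r \<le> dist y x} (u k) :: ennreal)"
      for u using J True by (auto simp: le_gap_iff indicator_def prod_zero_iff)
    have "(\<integral>\<^sup>+u. (\<Prod>k\<in>I - J. f k (u k)) * indicator {u. r \<le> gap J u y} u \<partial>cube_points I)
        = (\<integral>\<^sup>+u. (\<Prod>k\<in>I. \<phi> k (u k)) \<partial>cube_points I)"
      unfolding split ind by (simp add: \<phi>_def)
    also have "\<dots> = (\<Prod>k\<in>I. \<integral>\<^sup>+x. \<phi> k x \<partial>unit_cube_measure)"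
      using I \<phi> by (intro product_nn_integral_prod) auto
    also have "\<dots> = (\<Prod>k\<in>I - J. \<integral>\<^sup>+x. f k x \<partial>unit_cube_measure)
        * emeasure unit_cube_measure {x. r \<le> dist y x} ^ card J"
      unfolding split by (simp add: \<phi>_def)
    also have "emeasure unit_cube_measure {x. r \<le> dist y x} ^ card J \<le> ennreal (exp (- ?t)) ^ card J"
      using emeasure_far_from_point_le[OF y r] by (intro power_mono) auto
    also have "ennreal (exp (- ?t)) ^ card J = ennreal (exp (- (real (card J) * ?t)))"
      by (simp add: ennreal_power exp_of_nat_mult[symmetric])
    also have "\<dots> \<le> ennreal (exp (1 - real (card J + 1) * ?t))"
    proof -
      have "?t \<le> 1" using True r by (intro power_le_one) auto
      then show ?thesis by (intro ennreal_leI) (simp add: algebra_simps)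
    qed
    finally show ?thesis by (simp add: mult_left_mono)
  qed
qed

lemma ennreal_le_suminf: "f l \<le> suminf f" for f :: "nat \<Rightarrow> ennreal"
  using sum_le_suminf[of f "{l}"] by simp

definition moment_const :: "nat \<Rightarrow> real" where
  "moment_const d = (\<Sum>l. (real l + 2) ^ 8 * exp (1 - real l / sqrt (real d) ^ d))"

lemma summable_moment_const:
  assumes "0 < d"
  shows "summable (\<lambda>l. (real l + 2) ^ 8 * exp (1 - real l / sqrt (real d) ^ d))"
proof -
  define c where "c = 1 / sqrt (real d) ^ d"
  have "0 < c" using assms by (simp add: c_def)
  then have "(\<lambda>l. (real l + 2) ^ 8 * exp (1 - c * real l)) \<in> O(\<lambda>l. 1 / real l ^ 2)"
    by real_asymp
  moreover have "summable (\<lambda>l. norm (1 / real l ^ 2))"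
    using inverse_power_summable[of 2, where 'a = real] by (simp add: inverse_eq_divide)
  ultimately show ?thesis
    using summable_comparison_test_bigo by (fastforce simp: c_def)
qed

lemma moment_const_pos: "0 < d \<Longrightarrow> 0 < moment_const d"
  unfolding moment_const_def by (intro suminf_pos summable_moment_const) auto

text \<open>The volume \<open>gap J u y ^ d\<close> is of order \<open>1 / (card J + 1)\<close> with exponential tails. Rounding
  the normalised volume down to an integer \<open>l\<close> bounds the moment by a series over \<open>l\<close> of tail
  probabilities. The factors \<open>f k\<close>, which depend on the points outside \<open>J\<close> only, come along by
  independence. The power 8 is what the Cauchy--Schwarz argument for \<open>mean_gap\<close> below consumes.\<close>

lemma nn_integral_gap_moment_le:
  fixes y :: "real ^ 'd" and f :: "'i \<Rightarrow> real ^ 'd \<Rightarrow> ennreal"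
  assumes I: "finite I" "J \<subseteq> I" and y: "y \<in> open_unit_cube"
    and f: "\<And>k. k \<in> I - J \<Longrightarrow> f k \<in> borel_measurable borel"
  shows "(\<integral>\<^sup>+u. (\<Prod>k\<in>I - J. f k (u k))
            * ennreal ((1 + real (card J + 1) * gap J u y ^ CARD('d)) ^ 8) \<partial>cube_points I)
    \<le> ennreal (moment_const CARD('d)) * (\<Prod>k\<in>I - J. \<integral>\<^sup>+x. f k x \<partial>unit_cube_measure)"
proof -
  let ?d = "CARD('d)" and ?D = "sqrt (real CARD('d))" and ?m = "real (card J + 1)"
  let ?W = "\<lambda>u. \<Prod>k\<in>I - J. f k (u k)"
  let ?F = "\<Prod>k\<in>I - J. \<integral>\<^sup>+x. f k x \<partial>unit_cube_measure"
  have J: "finite J" using I finite_subset by auto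
  note f[measurable]
  have gap_meas [measurable]: "(\<lambda>u. gap J u y) \<in> borel_measurable (cube_points I)"
    using I J by (intro borel_measurable_gap) (auto intro!: measurable_component_singleton)
  have W [measurable]: "?W \<in> borel_measurable (cube_points I)"
    by (rule borel_measurable_prod_ennreal)
       (use f in \<open>auto intro!: measurable_compose[OF measurable_component_singleton]\<close>)
  define r where "r l = root ?d (real l / ?m)" for l :: nat
  have r0: "0 \<le> r l" for l by (simp add: r_def)
  have rd: "r l ^ ?d = real l / ?m" for l by (simp add: r_def)
  define c where "c l = (real l + 2) ^ 8" for l :: nat
  have c0: "0 \<le> c l" for l by (simp add: c_def)
  have pw: "ennreal ((1 + ?m * gap J u y ^ ?d) ^ 8)
      \<le> (\<Sum>l. ennreal (c l) * indicator {u. r l \<le> gap J u y} u)" for u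
  proof -
    let ?Y = "?m * gap J u y ^ ?d"
    have Y0: "0 \<le> ?Y" using gap_nonneg[OF J, of u y] by simp
    define l where "l = nat \<lfloor>?Y\<rfloor>"
    have l: "real l \<le> ?Y" "?Y < real l + 1" using Y0 by (simp_all add: l_def)
    have "r l ^ ?d \<le> gap J u y ^ ?d"
      unfolding rd using l(1) by (simp add: divide_le_eq mult.commute)
    then have "r l \<le> gap J u y"
      using gap_nonneg[OF J, of u y] by (rule power_le_imp_le_base[of _ "?d - 1", simplified])
    then have "ennreal (c l) = ennreal (c l) * indicator {u. r l \<le> gap J u y} u" by simp
    also have "\<dots> \<le> (\<Sum>l. ennreal (c l) * indicator {u. r l \<le> gap J u y} u)"
      by (rule ennreal_le_suminf)
    finally have "ennreal (c l) \<le> (\<Sum>l. ennreal (c l) * indicator {u. r l \<le> gap J u y} u)" .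
    moreover have "(1 + ?Y) ^ 8 \<le> c l" unfolding c_def using l Y0 by (intro power_mono) auto
    ultimately show ?thesis using ennreal_leI order_trans by blast
  qed
  have "(\<integral>\<^sup>+u. ?W u * ennreal ((1 + ?m * gap J u y ^ ?d) ^ 8) \<partial>cube_points I)
      \<le> (\<integral>\<^sup>+u. (\<Sum>l. ennreal (c l) * (?W u * indicator {u. r l \<le> gap J u y} u)) \<partial>cube_points I)"
  proof (rule nn_integral_mono)
    fix u
    have "?W u * ennreal ((1 + ?m * gap J u y ^ ?d) ^ 8)
        \<le> ?W u * (\<Sum>l. ennreal (c l) * indicator {u. r l \<le> gap J u y} u)"
      by (intro mult_left_mono pw) simp
    also have "\<dots> = (\<Sum>l. ?W u * (ennreal (c l) * indicator {u. r l \<le> gap J u y} u))"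
      by (rule ennreal_suminf_cmult[symmetric])
    finally show "?W u * ennreal ((1 + ?m * gap J u y ^ ?d) ^ 8)
        \<le> (\<Sum>l. ennreal (c l) * (?W u * indicator {u. r l \<le> gap J u y} u))"
      by (simp only: mult.left_commute)
  qed
  also have "\<dots> = (\<Sum>l. ennreal (c l) *
      (\<integral>\<^sup>+u. ?W u * indicator {u. r l \<le> gap J u y} u \<partial>cube_points I))"
    by (subst nn_integral_suminf) (auto simp: nn_integral_cmult)
  also have "\<dots> \<le> (\<Sum>l. ennreal (c l * exp (1 - real l / ?D ^ ?d)) * ?F)"
  proof (rule suminf_le)
    fix l
    have "?m * (r l / ?D) ^ ?d = real l / ?D ^ ?d"
      unfolding power_divide rd by simp
    then show "ennreal (c l) * (\<integral>\<^sup>+u. ?W u * indicator {u. r l \<le> gap J u y} u \<partial>cube_points I)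
        \<le> ennreal (c l * exp (1 - real l / ?D ^ ?d)) * ?F"
      using mult_left_mono[OF nn_integral_gap_tail_le[OF I y r0[of l] f], where c = "ennreal (c l)"] c0[of l]
      by (simp add: ennreal_mult mult_ac)
  qed auto
  also have "\<dots> = (\<Sum>l. ennreal (c l * exp (1 - real l / ?D ^ ?d))) * ?F"
    by (rule ennreal_suminf_multc)
  also have "(\<Sum>l. ennreal (c l * exp (1 - real l / ?D ^ ?d))) = ennreal (moment_const ?d)"
    unfolding moment_const_def c_def using summable_moment_const[of ?d]
    by (subst suminf_ennreal2) auto
  finally show ?thesis .
qed

definition weight_const :: "nat \<Rightarrow> real" where
  "weight_const d = unit_ball_vol (real d) * (\<Sum>l. 1 / (real l + 1)\<^sup>2)"

lemma summable_inverse_squares_shift: "summable (\<lambda>l. 1 / (real l + 1)\<^sup>2)"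
  using summable_Suc_iff[of "\<lambda>l. inverse (real l ^ 2)"] inverse_power_summable[of 2, where 'a = real]
  by (simp add: inverse_eq_divide add.commute)

lemma weight_const_pos: "0 < weight_const d"
  unfolding weight_const_def
  by (intro mult_pos_pos suminf_pos summable_inverse_squares_shift) auto

text \<open>The weight lives at the length scale \<open>m powr (-1/d)\<close>, hence the volume factor \<open>1 / m\<close>. The ball
  on which \<open>m * dist z y ^ d < l + 1\<close> has volume proportional to \<open>(l + 1) / m\<close>, so an exponent
  greater than 2 in the weight makes the series over \<open>l\<close> converge.\<close>

lemma nn_integral_weight_le:
  fixes z :: "real ^ 'd"
  assumes m: "0 < m"
  shows "(\<integral>\<^sup>+y. ennreal (1 / (1 + m * dist z y ^ CARD('d)) ^ 3) \<partial>unit_cube_measure)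
    \<le> ennreal (weight_const CARD('d) / m)"
proof -
  let ?d = "CARD('d)"
  let ?\<beta> = "unit_ball_vol (real ?d)"
  define R where "R l = root ?d ((real l + 1) / m)" for l :: nat
  have R0: "0 \<le> R l" for l using m by (simp add: R_def)
  have Rd: "R l ^ ?d = (real l + 1) / m" for l using m by (simp add: R_def)
  define c where "c l = 1 / (real l + 1) ^ 3" for l :: nat
  have pw: "ennreal (1 / (1 + m * dist z y ^ ?d) ^ 3) \<le> (\<Sum>l. ennreal (c l) * indicator (ball z (R l)) y)"
    for y
  proof -
    let ?Y = "m * dist z y ^ ?d"
    have Y0: "0 \<le> ?Y" using m by simp
    define l where "l = nat \<lfloor>?Y\<rfloor>"
    have l: "real l \<le> ?Y" "?Y < real l + 1" using Y0 by (simp_all add: l_def)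
    have "dist z y ^ ?d < R l ^ ?d"
      unfolding Rd using l(2) m by (simp add: less_divide_eq mult.commute)
    then have "dist z y < R l"
      using R0 by (rule power_less_imp_less_base)
    then have "ennreal (c l) = ennreal (c l) * indicator (ball z (R l)) y" by simp
    also have "\<dots> \<le> (\<Sum>l. ennreal (c l) * indicator (ball z (R l)) y)"
      by (rule ennreal_le_suminf)
    finally have "ennreal (c l) \<le> (\<Sum>l. ennreal (c l) * indicator (ball z (R l)) y)" .
    moreover have "1 / (1 + ?Y) ^ 3 \<le> c l"
      unfolding c_def using l by (intro divide_left_mono power_mono) auto
    ultimately show ?thesis using ennreal_leI order_trans by blast
  qed
  have [measurable]: "ball z (R l) \<in> sets unit_cube_measure" for l by simp
  have "(\<integral>\<^sup>+y. ennreal (1 / (1 + m * dist z y ^ ?d) ^ 3) \<partial>unit_cube_measure)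
      \<le> (\<integral>\<^sup>+y. (\<Sum>l. ennreal (c l) * indicator (ball z (R l)) y) \<partial>unit_cube_measure)"
    using pw by (intro nn_integral_mono)
  also have "\<dots> = (\<Sum>l. ennreal (c l) * emeasure unit_cube_measure (ball z (R l)))"
    by (subst nn_integral_suminf) (auto simp: nn_integral_cmult_indicator)
  also have "\<dots> \<le> (\<Sum>l. ennreal (?\<beta> / m * (1 / (real l + 1)\<^sup>2)))"
  proof (rule suminf_le)
    fix l
    have "emeasure unit_cube_measure (ball z (R l)) \<le> emeasure lborel (ball z (R l))"
      by (subst emeasure_unit_cube_measure) (auto intro!: emeasure_mono)
    also have "\<dots> = ennreal (?\<beta> * ((real l + 1) / m))"
      using emeasure_ball[OF R0, of z l] by (simp add: Rd)
    finally have "ennreal (c l) * emeasure unit_cube_measure (ball z (R l))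
        \<le> ennreal (c l) * ennreal (?\<beta> * ((real l + 1) / m))"
      by (rule mult_left_mono) simp
    also have "\<dots> = ennreal (c l * (?\<beta> * ((real l + 1) / m)))"
      using m by (subst ennreal_mult) (auto simp: c_def)
    also have "c l * (?\<beta> * ((real l + 1) / m)) = ?\<beta> / m * (1 / (real l + 1)\<^sup>2)"
    proof -
      have "1 / x ^ 3 * (?\<beta> * (x / m)) = ?\<beta> / m * (1 / x\<^sup>2)" if "0 < x" for x
        using that m by (simp add: field_simps power3_eq_cube power2_eq_square)
      then show ?thesis unfolding c_def by force
    qed
    finally show "ennreal (c l) * emeasure unit_cube_measure (ball z (R l))
        \<le> ennreal (?\<beta> / m * (1 / (real l + 1)\<^sup>2))" .
  qed auto
  also have "\<dots> = ennreal (\<Sum>l. ?\<beta> / m * (1 / (real l + 1)\<^sup>2))"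
    using m by (intro suminf_ennreal2 summable_mult summable_inverse_squares_shift) auto
  also have "(\<Sum>l. ?\<beta> / m * (1 / (real l + 1)\<^sup>2)) = weight_const ?d / m"
    unfolding weight_const_def using suminf_mult[OF summable_inverse_squares_shift, of "?\<beta> / m"]
    by simp
  finally show ?thesis .
qed

lemma gap_powr_le:
  fixes y :: "real ^ 'd"
  assumes "finite J" "0 \<le> s" "s \<le> 1" "0 < m"
  shows "gap J u y powr (real CARD('d) * s)
    \<le> m powr (- s) * (1 + m * gap J u y ^ CARD('d)) ^ 8"
proof -
  let ?G = "gap J u y" and ?d = "CARD('d)"
  have G: "0 \<le> ?G" using assms by (simp add: gap_nonneg)
  have "?G powr (real ?d * s) = (?G ^ ?d) powr s"
    using G by (cases "?G = 0") (simp_all add: powr_powr[symmetric] powr_realpow)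
  also have "\<dots> = m powr (- s) * (m * ?G ^ ?d) powr s"
    using assms G by (simp add: powr_mult powr_minus)
  also have "(m * ?G ^ ?d) powr s \<le> (1 + m * ?G ^ ?d) powr s"
    using assms G by (intro powr_mono2) auto
  also have "\<dots> \<le> (1 + m * ?G ^ ?d) powr 1"
    using assms G by (intro powr_mono) auto
  also have "\<dots> \<le> (1 + m * ?G ^ ?d) ^ 8"
    using assms G self_le_power[of "1 + m * ?G ^ ?d" 8] by simp
  finally show ?thesis using assms by (simp add: mult_left_mono)
qed

lemma nn_integral_gap_powr_le:
  fixes y :: "real ^ 'd"
  assumes "finite I" "J \<subseteq> I" "y \<in> open_unit_cube" "0 \<le> s" "s \<le> 1"
  shows "(\<integral>\<^sup>+u. ennreal (gap J u y powr (real CARD('d) * s)) \<partial>cube_points I)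
    \<le> ennreal (moment_const CARD('d) * real (card J + 1) powr (- s))"
proof -
  let ?m = "real (card J + 1)" and ?d = "CARD('d)"
  interpret Q: prob_space "unit_cube_measure :: (real ^ 'd) measure"
    by (rule prob_space_unit_cube_measure)
  have J: "finite J" using assms finite_subset by auto
  have [measurable]: "(\<lambda>u. gap J u y) \<in> borel_measurable (cube_points I)"
    using assms J by (intro borel_measurable_gap) (auto intro!: measurable_component_singleton)
  have "(\<integral>\<^sup>+u. ennreal (gap J u y powr (real ?d * s)) \<partial>cube_points I)
      \<le> (\<integral>\<^sup>+u. ennreal (?m powr (- s)) * ennreal ((1 + ?m * gap J u y ^ ?d) ^ 8) \<partial>cube_points I)"
    using gap_powr_le[OF J assms(4,5), of ?m]
    by (intro nn_integral_mono) (subst ennreal_mult[symmetric], auto intro!: ennreal_leI simp: gap_nonneg J)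
  also have "\<dots> = ennreal (?m powr (- s)) * (\<integral>\<^sup>+u. ennreal ((1 + ?m * gap J u y ^ ?d) ^ 8) \<partial>cube_points I)"
    by (rule nn_integral_cmult) measurable
  also have "\<dots> \<le> ennreal (?m powr (- s)) * ennreal (moment_const ?d)"
    using nn_integral_gap_moment_le[OF assms(1-3), of "\<lambda>_ _. 1"] Q.emeasure_space_1
    by (intro mult_left_mono) (auto simp: prod_constant)
  also have "\<dots> = ennreal (moment_const ?d * ?m powr (- s))"
    using moment_const_pos[of ?d] by (subst ennreal_mult[symmetric]) (auto simp: mult.commute)
  finally show ?thesis .
qed

section \<open>The influence of one point on the mean distance\<close>

text \<open>The conditional mean, given the points \<open>u k\<close> with \<open>k \<in> J\<close>, of the weight of the edge that joins
  a further uniform point to its nearest neighbour among them.\<close>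

definition mean_gap :: "real \<Rightarrow> 'i set \<Rightarrow> ('i \<Rightarrow> real ^ 'd) \<Rightarrow> real" where
  "mean_gap \<alpha> J u = (\<integral>y. gap J u y powr \<alpha> \<partial>unit_cube_measure)"

lemma mean_gap_cong: "(\<And>k. k \<in> J \<Longrightarrow> u k = v k) \<Longrightarrow> mean_gap \<alpha> J u = mean_gap \<alpha> J v"
  unfolding mean_gap_def by (simp add: gap_cong[of J u v])

lemma borel_measurable_gap_const [measurable]:
  "finite J \<Longrightarrow> (\<lambda>y. gap J u y) \<in> borel_measurable borel"
  by (rule borel_measurable_gap) auto

lemma borel_measurable_gap_pair:
  assumes "finite J" "J \<subseteq> I"
  shows "(\<lambda>(u, y). gap J u y) \<in> borel_measurable (cube_points I \<Otimes>\<^sub>M unit_cube_measure)"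
  unfolding split_beta' using assms
  by (intro borel_measurable_gap)
     (auto intro!: measurable_compose[OF measurable_fst] measurable_component_singleton)

lemma integrable_gap_powr:
  assumes "finite J" "0 \<le> \<alpha>"
  shows "integrable unit_cube_measure (\<lambda>y. gap J u y powr \<alpha>)"
proof -
  interpret Q: prob_space "unit_cube_measure :: (real ^ 'b) measure"
    by (rule prob_space_unit_cube_measure)
  show ?thesis using assms gap_powr_le_powr[OF assms, of u]
    by (intro Q.integrable_bounded) auto
qed

lemma mean_gap_bounds:
  fixes u :: "'i \<Rightarrow> real ^ 'd"
  assumes "finite J" "0 \<le> \<alpha>"
  shows "0 \<le> mean_gap \<alpha> J u" "mean_gap \<alpha> J u \<le> sqrt (real CARD('d)) powr \<alpha>"
proof -
  interpret Q: prob_space "unit_cube_measure :: (real ^ 'd) measure"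
    by (rule prob_space_unit_cube_measure)
  show "0 \<le> mean_gap \<alpha> J u" unfolding mean_gap_def by simp
  have "\<bar>mean_gap \<alpha> J u\<bar> \<le> sqrt (real CARD('d)) powr \<alpha>"
    unfolding mean_gap_def using assms gap_powr_le_powr[OF assms, of u]
    by (intro Q.abs_expectation_le) auto
  then show "mean_gap \<alpha> J u \<le> sqrt (real CARD('d)) powr \<alpha>" by simp
qed

lemma borel_measurable_mean_gap:
  fixes I :: "'i set"
  assumes "finite J" "J \<subseteq> I"
  shows "(\<lambda>u. mean_gap \<alpha> J u :: real) \<in> borel_measurable (cube_points I :: ('i \<Rightarrow> real ^ 'd) measure)"
proof -
  interpret Q: prob_space "unit_cube_measure :: (real ^ 'd) measure"
    by (rule prob_space_unit_cube_measure)
  have [measurable]: "(\<lambda>x. gap J (fst x) (snd x))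
      \<in> borel_measurable (cube_points I \<Otimes>\<^sub>M (unit_cube_measure :: (real ^ 'd) measure))"
    using borel_measurable_gap_pair[OF assms] by (simp add: split_beta')
  show ?thesis unfolding mean_gap_def
    by (rule Q.borel_measurable_lebesgue_integral) (unfold split_beta', measurable)
qed

lemma nn_integral_cube_points_swap:
  fixes f :: "('i \<Rightarrow> real ^ 'd) \<Rightarrow> real ^ 'd \<Rightarrow> ennreal"
  assumes "finite I" "(\<lambda>(u, y). f u y) \<in> borel_measurable (cube_points I \<Otimes>\<^sub>M unit_cube_measure)"
  shows "(\<integral>\<^sup>+u. (\<integral>\<^sup>+y. f u y \<partial>(unit_cube_measure :: (real ^ 'd) measure)) \<partial>cube_points I)
       = (\<integral>\<^sup>+y. (\<integral>\<^sup>+u. f u y \<partial>cube_points I) \<partial>unit_cube_measure)"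
proof -
  interpret Q: prob_space "unit_cube_measure :: (real ^ 'd) measure"
    by (rule prob_space_unit_cube_measure)
  interpret P: prob_space "cube_points I :: ('i \<Rightarrow> real ^ 'd) measure"
    by (rule prob_space_cube_points)
  interpret pair_sigma_finite "cube_points I :: ('i \<Rightarrow> real ^ 'd) measure"
    "unit_cube_measure :: (real ^ 'd) measure" ..
  show ?thesis using Fubini'[of f] assms(2) by simp
qed

lemma expectation_mean_gap_le:
  fixes I :: "'i set"
  assumes I: "finite I" "J \<subseteq> I" and s: "0 \<le> s" "s \<le> 1"
  shows "(\<integral>u. mean_gap (real CARD('d) * s) J u \<partial>(cube_points I :: ('i \<Rightarrow> real ^ 'd) measure))
    \<le> moment_const CARD('d) * real (card J + 1) powr (- s)"
proof -
  let ?P = "cube_points I :: ('i \<Rightarrow> real ^ 'd) measure" and ?\<alpha> = "real CARD('d) * s"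
  let ?C = "moment_const CARD('d) * real (card J + 1) powr (- s)"
  interpret Q: prob_space "unit_cube_measure :: (real ^ 'd) measure"
    by (rule prob_space_unit_cube_measure)
  interpret P: prob_space ?P by (rule prob_space_cube_points)
  have J: "finite J" using I finite_subset by auto
  have \<alpha>: "0 \<le> ?\<alpha>" using s by simp
  have [measurable]: "(\<lambda>x. gap J (fst x) (snd x)) \<in> borel_measurable (?P \<Otimes>\<^sub>M unit_cube_measure)"
    using borel_measurable_gap_pair[OF J I(2)] by (simp add: split_beta')
  have meas: "(\<lambda>(u, y). ennreal (gap J u y powr ?\<alpha>)) \<in> borel_measurable (?P \<Otimes>\<^sub>M unit_cube_measure)"
    unfolding split_beta' by measurable
  have "ennreal (\<integral>u. mean_gap ?\<alpha> J u \<partial>?P) = (\<integral>\<^sup>+u. ennreal (mean_gap ?\<alpha> J u) \<partial>?P)"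
    using mean_gap_bounds[OF J \<alpha>] borel_measurable_mean_gap[OF J I(2)]
    by (intro nn_integral_eq_integral[symmetric] P.integrable_bounded) auto
  also have "\<dots> = (\<integral>\<^sup>+u. (\<integral>\<^sup>+y. ennreal (gap J u y powr ?\<alpha>) \<partial>unit_cube_measure) \<partial>?P)"
    unfolding mean_gap_def using integrable_gap_powr[OF J \<alpha>]
    by (intro nn_integral_cong nn_integral_eq_integral[symmetric]) auto
  also have "\<dots> = (\<integral>\<^sup>+y. (\<integral>\<^sup>+u. ennreal (gap J u y powr ?\<alpha>) \<partial>?P) \<partial>unit_cube_measure)"
    by (rule nn_integral_cube_points_swap[OF I(1) meas])
  also have "\<dots> \<le> (\<integral>\<^sup>+(y :: real ^ 'd). ennreal ?C \<partial>unit_cube_measure)"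
    by (intro nn_integral_mono_AE eventually_mono[OF AE_unit_cube_measure] nn_integral_gap_powr_le I s)
  also have "\<dots> = ennreal ?C" using Q.emeasure_space_1 by simp
  finally show ?thesis
    using moment_const_pos[of "CARD('d)"] by (subst (asm) ennreal_le_iff) auto
qed

text \<open>A new point \<open>u i\<close> changes the gap only at those \<open>y\<close> that are closer to \<open>u i\<close> than the gap, a
  random region of volume of order \<open>1 / m\<close>. Cauchy--Schwarz with the weight
  \<open>(1 + m * dist y (u i) ^ d) ^ 4\<close> localises the integral near \<open>u i\<close>: on that region the weight is
  bounded by a power of the normalised volume \<open>m * gap J u y ^ d\<close>, and the moments of the latter are
  bounded.\<close>

lemma mean_gap_insert_diff_power2_le:
  fixes u :: "'i \<Rightarrow> real ^ 'd"
  assumes J: "finite J" and s: "0 \<le> s" "s \<le> 1 / 2" and m: "0 < m"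
  defines "\<alpha> \<equiv> real CARD('d) * s"
  shows "ennreal ((mean_gap \<alpha> J u - mean_gap \<alpha> (insert i J) u)\<^sup>2)
    \<le> ennreal (weight_const CARD('d) / m * m powr (- 2 * s)) *
      (\<integral>\<^sup>+y. ennreal (1 / (1 + m * dist y (u i) ^ CARD('d)) ^ 3)
          * ennreal ((1 + m * gap J u y ^ CARD('d)) ^ 8) \<partial>unit_cube_measure)"
proof -
  let ?d = "CARD('d)"
  let ?Q = "unit_cube_measure :: (real ^ 'd) measure"
  let ?w = "\<lambda>y. 1 + m * dist y (u i) ^ ?d"
  let ?g = "\<lambda>y. gap J u y" and ?g' = "\<lambda>y. gap (insert i J) u y"
  interpret Q: prob_space ?Q by (rule prob_space_unit_cube_measure)
  have \<alpha>: "0 \<le> \<alpha>" using s by (simp add: \<alpha>_def)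
  have g0: "0 \<le> ?g y" for y by (rule gap_nonneg[OF J])
  have w1: "1 \<le> ?w y" for y using m by simp
  define A where "A y = ennreal (1 / (?w y)\<^sup>2)" for y
  define B where "B y = ennreal ((?w y)\<^sup>2 * (if dist y (u i) < ?g y then ?g y powr \<alpha> else 0))" for y
  have [measurable]: "(\<lambda>y. ?g y) \<in> borel_measurable borel" by (rule borel_measurable_gap_const[OF J])
  have [measurable]: "A \<in> borel_measurable ?Q" "B \<in> borel_measurable ?Q"
    unfolding A_def B_def by measurable
  have le: "?g' y powr \<alpha> \<le> ?g y powr \<alpha>" for y
    using gap_nonneg[of "insert i J" u y] J \<alpha> by (intro powr_mono2) (auto simp: gap_insert)
  have diff_le: "ennreal (?g y powr \<alpha> - ?g' y powr \<alpha>) \<le> A y * B y" for y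
  proof -
    have "A y * B y = ennreal (if dist y (u i) < ?g y then ?g y powr \<alpha> else 0)"
      unfolding A_def B_def using w1[of y] by (subst ennreal_mult[symmetric]) auto
    moreover have "?g y powr \<alpha> - ?g' y powr \<alpha> \<le> (if dist y (u i) < ?g y then ?g y powr \<alpha> else 0)"
      using J by (auto simp: gap_insert min_def)
    ultimately show ?thesis by (simp add: ennreal_leI)
  qed
  have A2: "(A y)\<^sup>2 \<le> ennreal (1 / (1 + m * dist (u i) y ^ ?d) ^ 3)" for y
  proof -
    have "(1 / (?w y)\<^sup>2)\<^sup>2 = 1 / ?w y ^ 4" by (simp add: power_divide)
    also have "\<dots> \<le> 1 / ?w y ^ 3"
      using w1[of y] by (intro divide_left_mono power_increasing) auto
    finally show ?thesis unfolding A_def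
      by (simp add: ennreal_power dist_commute[of "u i"] ennreal_leI)
  qed
  have B2: "(B y)\<^sup>2 \<le> ennreal (m powr (- 2 * s))
      * (ennreal (1 / ?w y ^ 3) * ennreal ((1 + m * ?g y ^ ?d) ^ 8))" for y
  proof (cases "dist y (u i) < ?g y")
    case True
    have W: "?w y \<le> 1 + m * ?g y ^ ?d"
      using True m by (intro add_left_mono mult_left_mono power_mono) auto
    let ?G = "1 + m * ?g y ^ ?d"
    have G1: "1 \<le> ?G" using m g0[of y] by simp
    have "(?g y powr \<alpha>)\<^sup>2 = ?g y powr (real ?d * (2 * s))"
      by (simp add: \<alpha>_def power2_eq_square powr_add[symmetric] mult_ac)
    also have "\<dots> = (?g y ^ ?d) powr (2 * s)"
      using g0[of y] by (cases "?g y = 0") (simp_all add: powr_powr[symmetric] powr_realpow)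
    also have "\<dots> = m powr (- 2 * s) * (m * ?g y ^ ?d) powr (2 * s)"
      using m g0[of y] by (simp add: powr_mult powr_minus)
    also have "(m * ?g y ^ ?d) powr (2 * s) \<le> ?G powr (2 * s)"
      using m g0[of y] s by (intro powr_mono2) auto
    also have "?G powr (2 * s) \<le> ?G powr 1"
      using G1 s by (intro powr_mono) auto
    finally have gp: "(?g y powr \<alpha>)\<^sup>2 \<le> m powr (- 2 * s) * ?G"
      using G1 by (simp add: mult_left_mono)
    have "((?w y)\<^sup>2 * ?g y powr \<alpha>)\<^sup>2 = 1 / ?w y ^ 3 * (?w y ^ 7 * (?g y powr \<alpha>)\<^sup>2)"
    proof -
      have "(w\<^sup>2 * p)\<^sup>2 = 1 / w ^ 3 * (w ^ 7 * p\<^sup>2)" if "1 \<le> w" for w p :: real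
      proof -
        have "w ^ 7 = w ^ 3 * w ^ 4" by (simp add: power_add[symmetric])
        moreover have "1 / w ^ 3 * (w ^ 3 * (w ^ 4 * p\<^sup>2)) = w ^ 4 * p\<^sup>2"
        proof -
          have cancel: "1 / a * (a * x) = x" if "a \<noteq> 0" for a x :: real using that by simp
          show ?thesis by (rule cancel) (use that in simp)
        qed
        moreover have "(w\<^sup>2 * p)\<^sup>2 = w ^ 4 * p\<^sup>2" by (simp add: power_mult_distrib)
        ultimately show ?thesis by (metis mult.assoc)
      qed
      then show ?thesis using w1[of y] by blast
    qed
    also have "\<dots> \<le> 1 / ?w y ^ 3 * (?G ^ 7 * (m powr (- 2 * s) * ?G))"
      using W w1[of y] gp by (intro mult_left_mono mult_mono power_mono) auto
    also have "?G ^ 7 * (m powr (- 2 * s) * ?G) = m powr (- 2 * s) * ?G ^ 8"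
      by (simp add: power_Suc[of _ 7, simplified])
    finally have "((?w y)\<^sup>2 * ?g y powr \<alpha>)\<^sup>2 \<le> m powr (- 2 * s) * (1 / ?w y ^ 3 * ?G ^ 8)"
      by (simp add: mult.left_commute)
    then have "ennreal (((?w y)\<^sup>2 * ?g y powr \<alpha>)\<^sup>2) \<le> ennreal (m powr (- 2 * s) * (1 / ?w y ^ 3 * ?G ^ 8))"
      by (rule ennreal_leI)
    also have "\<dots> = ennreal (m powr (- 2 * s)) * (ennreal (1 / ?w y ^ 3) * ennreal (?G ^ 8))"
    proof -
      have nn: "0 \<le> m powr (- 2 * s)" "0 \<le> 1 / ?w y ^ 3" "0 \<le> ?G ^ 8"
        using w1[of y] G1 by simp_all
      show ?thesis
        unfolding ennreal_mult[OF nn(1) mult_nonneg_nonneg[OF nn(2,3)]] ennreal_mult[OF nn(2,3)] ..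
    qed
    finally show ?thesis unfolding B_def using True by (simp add: ennreal_power)
  next
    case False
    then show ?thesis by (simp add: B_def)
  qed
  have "mean_gap \<alpha> J u - mean_gap \<alpha> (insert i J) u = (\<integral>y. ?g y powr \<alpha> - ?g' y powr \<alpha> \<partial>?Q)"
    unfolding mean_gap_def using J \<alpha>
    by (intro Bochner_Integration.integral_diff[symmetric] integrable_gap_powr) auto
  then have "ennreal (mean_gap \<alpha> J u - mean_gap \<alpha> (insert i J) u)
      = (\<integral>\<^sup>+y. ennreal (?g y powr \<alpha> - ?g' y powr \<alpha>) \<partial>?Q)"
    using J \<alpha> le by (subst nn_integral_eq_integral)
      (auto intro!: Bochner_Integration.integrable_diff integrable_gap_powr)
  also have "\<dots> \<le> (\<integral>\<^sup>+y. A y * B y \<partial>?Q)"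
    by (intro nn_integral_mono diff_le)
  finally have 1: "ennreal (mean_gap \<alpha> J u - mean_gap \<alpha> (insert i J) u) \<le> (\<integral>\<^sup>+y. A y * B y \<partial>?Q)" .
  have "mean_gap \<alpha> (insert i J) u \<le> mean_gap \<alpha> J u"
    unfolding mean_gap_def using J \<alpha> le by (intro integral_mono integrable_gap_powr) auto
  then have "ennreal ((mean_gap \<alpha> J u - mean_gap \<alpha> (insert i J) u)\<^sup>2)
      = (ennreal (mean_gap \<alpha> J u - mean_gap \<alpha> (insert i J) u))\<^sup>2"
    by (simp add: ennreal_power)
  also have "\<dots> \<le> (\<integral>\<^sup>+y. A y * B y \<partial>?Q)\<^sup>2"
    using 1 by (rule power_mono) simp
  also have "\<dots> \<le> (\<integral>\<^sup>+y. (A y)\<^sup>2 \<partial>?Q) * (\<integral>\<^sup>+y. (B y)\<^sup>2 \<partial>?Q)"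
    by (rule Cauchy_Schwarz_nn_integral) measurable
  also have "\<dots> \<le> ennreal (weight_const ?d / m) * (\<integral>\<^sup>+y. ennreal (m powr (- 2 * s))
      * (ennreal (1 / ?w y ^ 3) * ennreal ((1 + m * ?g y ^ ?d) ^ 8)) \<partial>?Q)"
    using nn_integral_weight_le[OF m, of "u i"]
    by (intro mult_mono nn_integral_mono B2)
       (auto intro: order.trans[OF nn_integral_mono[OF A2]])
  also have "\<dots> = ennreal (weight_const ?d / m) * (ennreal (m powr (- 2 * s)) *
      (\<integral>\<^sup>+y. ennreal (1 / ?w y ^ 3) * ennreal ((1 + m * ?g y ^ ?d) ^ 8) \<partial>?Q))"
    by (subst nn_integral_cmult) auto
  also have "\<dots> = ennreal (weight_const ?d / m * m powr (- 2 * s)) *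
      (\<integral>\<^sup>+y. ennreal (1 / ?w y ^ 3) * ennreal ((1 + m * ?g y ^ ?d) ^ 8) \<partial>?Q)"
    using m weight_const_pos[of ?d] by (subst ennreal_mult) (auto simp: mult.assoc)
  finally show ?thesis .
qed

text \<open>For fixed \<open>y\<close>, the weight depends on \<open>u i\<close> and the gap on the points of \<open>J\<close> only, so the two
  are independent. The weight contributes one factor \<open>1 / m\<close> here and another in the preceding
  lemma, which makes the influence of one point smaller than the edge weight \<open>m powr (-s)\<close> by
  the factor \<open>1 / m\<close>, also in the mean square.\<close>

lemma expectation_mean_gap_insert_diff_power2_le:
  fixes I :: "'i set"
  assumes I: "finite I" "J \<subseteq> I" and i: "i \<in> I - J" and s: "0 \<le> s" "s \<le> 1 / 2"
  defines "\<alpha> \<equiv> real CARD('d) * s" and "m \<equiv> real (card J + 1)"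
  shows "(\<integral>u. (mean_gap \<alpha> J u - mean_gap \<alpha> (insert i J) u)\<^sup>2 \<partial>(cube_points I :: ('i \<Rightarrow> real ^ 'd) measure))
    \<le> moment_const CARD('d) * (weight_const CARD('d))\<^sup>2 * (m powr (- 1 - s))\<^sup>2"
proof -
  let ?d = "CARD('d)"
  let ?Q = "unit_cube_measure :: (real ^ 'd) measure"
  let ?P = "cube_points I :: ('i \<Rightarrow> real ^ 'd) measure"
  let ?\<kappa> = "weight_const ?d" and ?c = "moment_const ?d"
  let ?h = "\<lambda>u y. ennreal (1 / (1 + m * dist y (u i) ^ ?d) ^ 3) * ennreal ((1 + m * gap J u y ^ ?d) ^ 8)"
  interpret Q: prob_space ?Q by (rule prob_space_unit_cube_measure)
  interpret P: prob_space ?P by (rule prob_space_cube_points)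
  have J: "finite J" and J': "finite (insert i J)" "insert i J \<subseteq> I"
    using I i finite_subset by auto
  have \<alpha>: "0 \<le> \<alpha>" using s by (simp add: \<alpha>_def)
  have m: "0 < m" by (simp add: m_def)
  note pos = weight_const_pos[of ?d] moment_const_pos[of ?d]
  have [measurable]: "(\<lambda>x. gap J (fst x) (snd x)) \<in> borel_measurable (?P \<Otimes>\<^sub>M ?Q)"
    using borel_measurable_gap_pair[OF J I(2)] by (simp add: split_beta')
  have [measurable]: "(\<lambda>x. (fst x) i) \<in> borel_measurable (?P \<Otimes>\<^sub>M ?Q)"
    using i by (auto intro!: measurable_compose[OF measurable_fst] measurable_component_singleton)
  have [measurable]: "(\<lambda>x. snd x) \<in> borel_measurable (?P \<Otimes>\<^sub>M ?Q)" by simp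
  have meas: "(\<lambda>(u, y). ?h u y) \<in> borel_measurable (?P \<Otimes>\<^sub>M ?Q)"
    unfolding split_beta' by measurable
  have bound: "\<bar>(mean_gap \<alpha> J u - mean_gap \<alpha> (insert i J) u)\<^sup>2\<bar> \<le> (sqrt (real ?d) powr \<alpha>)\<^sup>2" for u :: "'i \<Rightarrow> real ^ 'd"
    using mean_gap_bounds[OF J \<alpha>, of u] mean_gap_bounds[OF J'(1) \<alpha>, of u]
    by (intro abs_power2_le) linarith
  note [measurable] = borel_measurable_mean_gap[OF J I(2)] borel_measurable_mean_gap[OF J']
  have inner: "(\<integral>\<^sup>+u. ?h u y \<partial>?P) \<le> ennreal (?c * (?\<kappa> / m))" if y: "y \<in> open_unit_cube" for y
  proof -
    define f where "f k x = (if k = i then ennreal (1 / (1 + m * dist y x ^ ?d) ^ 3) else 1)"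
      for k :: 'i and x :: "real ^ 'd"
    have "(\<Prod>k\<in>I - J. f k (u k)) = ennreal (1 / (1 + m * dist y (u i) ^ ?d) ^ 3)" for u
      using I i unfolding f_def by (subst prod.delta) auto
    moreover have "(\<Prod>k\<in>I - J. \<integral>\<^sup>+x. f k x \<partial>?Q)
        = (\<integral>\<^sup>+x. ennreal (1 / (1 + m * dist y x ^ ?d) ^ 3) \<partial>?Q)"
    proof -
      have "(\<integral>\<^sup>+x. f k x \<partial>?Q)
          = (if k = i then \<integral>\<^sup>+x. ennreal (1 / (1 + m * dist y x ^ ?d) ^ 3) \<partial>?Q else 1)" for k
        using Q.emeasure_space_1 by (simp add: f_def)
      then show ?thesis using I i by (simp add: prod.delta)
    qed
    moreover have "f k \<in> borel_measurable borel" for k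
      by (cases "k = i") (simp_all add: f_def[abs_def])
    ultimately have "(\<integral>\<^sup>+u. ?h u y \<partial>?P)
        \<le> ennreal ?c * (\<integral>\<^sup>+x. ennreal (1 / (1 + m * dist y x ^ ?d) ^ 3) \<partial>?Q)"
      using nn_integral_gap_moment_le[OF I y, of f] by (simp add: m_def)
    also have "\<dots> \<le> ennreal ?c * ennreal (?\<kappa> / m)"
      by (intro mult_left_mono nn_integral_weight_le m) simp
    also have "\<dots> = ennreal (?c * (?\<kappa> / m))"
      using pos m by (subst ennreal_mult) auto
    finally show ?thesis .
  qed
  have "ennreal (\<integral>u. (mean_gap \<alpha> J u - mean_gap \<alpha> (insert i J) u)\<^sup>2 \<partial>?P)
      = (\<integral>\<^sup>+u. ennreal ((mean_gap \<alpha> J u - mean_gap \<alpha> (insert i J) u)\<^sup>2) \<partial>?P)"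
    using bound by (intro nn_integral_eq_integral[symmetric] P.integrable_bounded) auto
  also have "\<dots> \<le> (\<integral>\<^sup>+u. ennreal (?\<kappa> / m * m powr (- 2 * s)) * (\<integral>\<^sup>+y. ?h u y \<partial>?Q) \<partial>?P)"
    unfolding \<alpha>_def by (intro nn_integral_mono mean_gap_insert_diff_power2_le J s m)
  also have "\<dots> = ennreal (?\<kappa> / m * m powr (- 2 * s)) * (\<integral>\<^sup>+u. (\<integral>\<^sup>+y. ?h u y \<partial>?Q) \<partial>?P)"
    using Q.borel_measurable_nn_integral[OF meas] by (intro nn_integral_cmult)
  also have "(\<integral>\<^sup>+u. (\<integral>\<^sup>+y. ?h u y \<partial>?Q) \<partial>?P) = (\<integral>\<^sup>+y. (\<integral>\<^sup>+u. ?h u y \<partial>?P) \<partial>?Q)"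
    by (rule nn_integral_cube_points_swap[OF I(1) meas])
  also have "\<dots> \<le> (\<integral>\<^sup>+y. ennreal (?c * (?\<kappa> / m)) \<partial>?Q)"
    by (intro nn_integral_mono_AE eventually_mono[OF AE_unit_cube_measure] inner)
  also have "\<dots> = ennreal (?c * (?\<kappa> / m))" using Q.emeasure_space_1 by simp
  also have "ennreal (?\<kappa> / m * m powr (- 2 * s)) * ennreal (?c * (?\<kappa> / m))
      = ennreal (?\<kappa> / m * m powr (- 2 * s) * (?c * (?\<kappa> / m)))"
    using pos m by (subst ennreal_mult) auto
  also have "?\<kappa> / m * m powr (- 2 * s) * (?c * (?\<kappa> / m)) = ?c * ?\<kappa>\<^sup>2 * (m powr (- 1 - s))\<^sup>2"
  proof -
    have "(m powr (- 1 - s))\<^sup>2 = m powr (- 2 * s) * (1 / m) * (1 / m)"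
    proof -
      have "m powr (- 1 - s) = m powr (- s) * (1 / m)"
        using m by (simp add: powr_diff powr_minus field_simps)
      moreover have "m powr (- 2 * s) = m powr (- s) * m powr (- s)"
        by (simp add: powr_add[symmetric])
      ultimately show ?thesis by (simp add: power2_eq_square)
    qed
    then show ?thesis by (simp add: power2_eq_square)
  qed
  finally have "ennreal (\<integral>u. (mean_gap \<alpha> J u - mean_gap \<alpha> (insert i J) u)\<^sup>2 \<partial>?P)
      \<le> ennreal (?c * ?\<kappa>\<^sup>2 * (m powr (- 1 - s))\<^sup>2)"
    by (simp add: mult_left_mono)
  then show ?thesis using pos by (subst (asm) ennreal_le_iff) auto
qed

section \<open>Variance of the length for a fixed number of points\<close>

(* Keeps index sets in the form {1..n}. *)
declare One_nat_def [simp del]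

text \<open>The length of the graph in terms of \<open>gap\<close>, indexed so that the \<open>j\<close>-th summand adds the point
  \<open>j + 1\<close> to \<open>j\<close> earlier points.\<close>

definition gap_length :: "real \<Rightarrow> (nat \<Rightarrow> real ^ 'd) \<Rightarrow> nat \<Rightarrow> real" where
  "gap_length \<alpha> u n = (\<Sum>j\<in>{1..<n}. gap {1..j} u (u (Suc j)) powr \<alpha>)"

text \<open>The predictable part in the Doob decomposition of \<open>gap_length\<close>.\<close>

definition compensator :: "real \<Rightarrow> (nat \<Rightarrow> real ^ 'd) \<Rightarrow> nat \<Rightarrow> real" where
  "compensator \<alpha> u n = (\<Sum>j\<in>{1..<n}. mean_gap \<alpha> {1..j} u)"

lemma borel_measurable_gap_length:
  "(\<lambda>u. gap_length \<alpha> u n) \<in> borel_measurable (cube_points {1..n} :: (nat \<Rightarrow> real ^ 'd) measure)"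
  unfolding gap_length_def
  by (intro borel_measurable_sum powr_real_measurable borel_measurable_gap)
     (auto intro!: measurable_component_singleton)

lemma borel_measurable_compensator:
  "(\<lambda>u. compensator \<alpha> u n) \<in> borel_measurable (cube_points {1..n} :: (nat \<Rightarrow> real ^ 'd) measure)"
  unfolding compensator_def
  by (intro borel_measurable_sum borel_measurable_mean_gap) auto

lemma abs_sum_le_card:
  fixes f :: "'a \<Rightarrow> real"
  assumes "\<And>j. j \<in> A \<Longrightarrow> 0 \<le> f j \<and> f j \<le> b"
  shows "\<bar>sum f A\<bar> \<le> real (card A) * b"
  using sum_bounded_above[of A f b] sum_nonneg[of A f] assms by auto

lemma abs_gap_length_le:
  fixes u :: "nat \<Rightarrow> real ^ 'd"
  assumes "0 \<le> \<alpha>"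
  shows "\<bar>gap_length \<alpha> u n\<bar> \<le> real n * sqrt (real CARD('d)) powr \<alpha>"
proof -
  have "\<bar>gap_length \<alpha> u n\<bar> \<le> real (card {1..<n}) * sqrt (real CARD('d)) powr \<alpha>"
    unfolding gap_length_def by (intro abs_sum_le_card) (auto intro!: gap_powr_le_powr assms)
  also have "\<dots> \<le> real n * sqrt (real CARD('d)) powr \<alpha>"
    by (intro mult_right_mono) auto
  finally show ?thesis .
qed

lemma abs_compensator_le:
  fixes u :: "nat \<Rightarrow> real ^ 'd"
  assumes "0 \<le> \<alpha>"
  shows "\<bar>compensator \<alpha> u n\<bar> \<le> real n * sqrt (real CARD('d)) powr \<alpha>"
proof -
  have "\<bar>compensator \<alpha> u n\<bar> \<le> real (card {1..<n}) * sqrt (real CARD('d)) powr \<alpha>"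
    unfolding compensator_def using assms by (intro abs_sum_le_card) (auto intro!: mean_gap_bounds)
  also have "\<dots> \<le> real n * sqrt (real CARD('d)) powr \<alpha>"
    by (intro mult_right_mono) auto
  finally show ?thesis .
qed

lemma gap_length_fun_upd:
  assumes "1 \<le> n"
  shows "gap_length \<alpha> (u(Suc n := y)) (Suc n) = gap_length \<alpha> u n + gap {1..n} u y powr \<alpha>"
proof -
  have "gap_length \<alpha> (u(Suc n := y)) n = gap_length \<alpha> u n"
    unfolding gap_length_def
    by (intro sum.cong refl arg_cong[where f = "\<lambda>x. x powr \<alpha>"])
       (auto intro!: gap_cong)
  moreover have "gap {1..n} (u(Suc n := y)) y = gap {1..n} u y"
    by (rule gap_cong) auto
  ultimately show ?thesis
    using assms by (simp add: gap_length_def atLeastLessThanSuc)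
qed

lemma compensator_fun_upd:
  assumes "1 \<le> n"
  shows "compensator \<alpha> (u(Suc n := y)) (Suc n) = compensator \<alpha> u n + mean_gap \<alpha> {1..n} u"
proof -
  have "mean_gap \<alpha> {1..j} (u(Suc n := y)) = mean_gap \<alpha> {1..j} u" if "j \<le> n" for j
    using that by (intro mean_gap_cong) auto
  then show ?thesis
    using assms by (simp add: compensator_def atLeastLessThanSuc)
qed

lemma integral_cube_points_Suc:
  fixes f :: "(nat \<Rightarrow> real ^ 'd) \<Rightarrow> real"
  assumes "f \<in> borel_measurable (cube_points {1..Suc n})" "\<And>u. \<bar>f u\<bar> \<le> B"
  shows "(\<integral>u. f u \<partial>cube_points {1..Suc n})
    = (\<integral>u. (\<integral>y. f (u(Suc n := y)) \<partial>unit_cube_measure) \<partial>cube_points {1..n})"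
proof -
  interpret Q: prob_space "unit_cube_measure :: (real ^ 'd) measure"
    by (rule prob_space_unit_cube_measure)
  interpret P: prob_space "cube_points {1..Suc n} :: (nat \<Rightarrow> real ^ 'd) measure"
    by (rule prob_space_cube_points)
  interpret product_sigma_finite "\<lambda>_ :: nat. unit_cube_measure :: (real ^ 'd) measure"
    by standard
  have *: "{1..Suc n} = insert (Suc n) {1..n}" by auto
  show ?thesis
    using product_integral_insert[of "{1..n}" "Suc n" f] P.integrable_bounded[OF assms]
    unfolding * by simp
qed

lemma integrable_gap_length:
  assumes "0 \<le> \<alpha>"
  shows "integrable (cube_points {1..n} :: (nat \<Rightarrow> real ^ 'd) measure) (\<lambda>u. gap_length \<alpha> u n)"
    "integrable (cube_points {1..n} :: (nat \<Rightarrow> real ^ 'd) measure) (\<lambda>u. (gap_length \<alpha> u n)\<^sup>2)"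
proof -
  interpret P: prob_space "cube_points {1..n} :: (nat \<Rightarrow> real ^ 'd) measure"
    by (rule prob_space_cube_points)
  note [measurable] = borel_measurable_gap_length[of \<alpha> n, where 'd = 'd]
  show "integrable (cube_points {1..n} :: (nat \<Rightarrow> real ^ 'd) measure) (\<lambda>u. gap_length \<alpha> u n)"
    using abs_gap_length_le[OF assms] by (intro P.integrable_bounded) auto
  show "integrable (cube_points {1..n} :: (nat \<Rightarrow> real ^ 'd) measure) (\<lambda>u. (gap_length \<alpha> u n)\<^sup>2)"
    using abs_power2_le[OF abs_gap_length_le[OF assms]] by (intro P.integrable_bounded) auto
qed

lemma integrable_mean_gap:
  fixes I :: "'i set"
  assumes "finite J" "J \<subseteq> I" "0 \<le> \<alpha>"
  shows "integrable (cube_points I :: ('i \<Rightarrow> real ^ 'd) measure) (\<lambda>u. mean_gap \<alpha> J u)"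
proof -
  interpret P: prob_space "cube_points I :: ('i \<Rightarrow> real ^ 'd) measure"
    by (rule prob_space_cube_points)
  show ?thesis
    using mean_gap_bounds[OF assms(1,3), where 'd = 'd] borel_measurable_mean_gap[OF assms(1,2)]
    by (intro P.integrable_bounded[where B = "sqrt (real CARD('d)) powr \<alpha>"]) auto
qed

text \<open>The type argument carries the dimension, which the other arguments do not determine.\<close>

definition mean_length :: "'d :: finite itself \<Rightarrow> real \<Rightarrow> nat \<Rightarrow> real" where
  "mean_length _ \<alpha> n = (\<integral>u. gap_length \<alpha> u n \<partial>(cube_points {1..n} :: (nat \<Rightarrow> real ^ 'd) measure))"

lemma mean_length_Suc_diff:
  fixes n :: nat
  assumes s: "0 \<le> s" "s \<le> 1"
  defines "\<alpha> \<equiv> real CARD('d) * s"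
  shows "mean_length TYPE('d :: finite) \<alpha> (Suc n) - mean_length TYPE('d) \<alpha> n
    \<in> {0..moment_const CARD('d) * real (Suc n) powr (- s)}"
proof (cases "n = 0")
  case True
  then show ?thesis
    using moment_const_pos[of "CARD('d)"] by (simp add: mean_length_def gap_length_def)
next
  case False
  then have n: "1 \<le> n" by simp
  let ?Q = "unit_cube_measure :: (real ^ 'd) measure"
  let ?P = "cube_points {1..n} :: (nat \<Rightarrow> real ^ 'd) measure"
  interpret Q: prob_space ?Q by (rule prob_space_unit_cube_measure)
  have \<alpha>: "0 \<le> \<alpha>" using s by (simp add: \<alpha>_def)
  have "mean_length TYPE('d) \<alpha> (Suc n)
      = (\<integral>u. (\<integral>y. gap_length \<alpha> u n + gap {1..n} u y powr \<alpha> \<partial>?Q) \<partial>?P)"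
    unfolding mean_length_def
    using borel_measurable_gap_length abs_gap_length_le[OF \<alpha>]
    by (subst integral_cube_points_Suc) (simp_all add: gap_length_fun_upd[OF n])
  also have "\<dots> = (\<integral>u. gap_length \<alpha> u n + mean_gap \<alpha> {1..n} u \<partial>?P)"
  proof (intro Bochner_Integration.integral_cong refl)
    fix u :: "nat \<Rightarrow> real ^ 'd"
    have "(\<integral>y. gap_length \<alpha> u n + gap {1..n} u y powr \<alpha> \<partial>?Q)
        = (\<integral>(y :: real ^ 'd). gap_length \<alpha> u n \<partial>?Q) + (\<integral>y. gap {1..n} u y powr \<alpha> \<partial>?Q)"
      using \<alpha> by (intro Bochner_Integration.integral_add integrable_gap_powr Q.integrable_const) auto
    then show "(\<integral>y. gap_length \<alpha> u n + gap {1..n} u y powr \<alpha> \<partial>?Q)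
        = gap_length \<alpha> u n + mean_gap \<alpha> {1..n} u"
      using Q.prob_space by (simp add: mean_gap_def)
  qed
  also have "\<dots> = mean_length TYPE('d) \<alpha> n + (\<integral>u. mean_gap \<alpha> {1..n} u \<partial>?P)"
    unfolding mean_length_def using \<alpha>
    by (intro Bochner_Integration.integral_add integrable_gap_length integrable_mean_gap) auto
  finally have eq: "mean_length TYPE('d) \<alpha> (Suc n) - mean_length TYPE('d) \<alpha> n
      = (\<integral>u. mean_gap \<alpha> {1..n} u \<partial>?P)" by simp
  have "0 \<le> (\<integral>u. mean_gap \<alpha> {1..n} u \<partial>?P)"
    by (intro integral_nonneg_AE AE_I2 mean_gap_bounds \<alpha>) auto
  moreover have "(\<integral>u. mean_gap \<alpha> {1..n} u \<partial>?P) \<le> moment_const CARD('d) * real (Suc n) powr (- s)"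
    using expectation_mean_gap_le[of "{1..n}" "{1..n}" s, where 'd = 'd] s
    by (simp add: \<alpha>_def add.commute)
  ultimately show ?thesis unfolding eq by simp
qed

text \<open>The difference is a martingale: its increments are centred given the earlier points, hence
  orthogonal, and the second moment of an increment is at most that of an edge weight.\<close>

lemma expectation_compensated_power2_le:
  fixes n :: nat
  assumes s: "0 \<le> s" "s \<le> 1 / 2"
  defines "\<alpha> \<equiv> real CARD('d) * s"
  shows "(\<integral>u. (gap_length \<alpha> u n - compensator \<alpha> u n)\<^sup>2 \<partial>(cube_points {1..n} :: (nat \<Rightarrow> real ^ 'd) measure))
    \<le> moment_const CARD('d) * (\<Sum>j\<in>{1..<n}. real (Suc j) powr (- 2 * s))"
proof (induction n)
  case 0
  then show ?case by (simp add: gap_length_def compensator_def)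
next
  case (Suc n)
  let ?Q = "unit_cube_measure :: (real ^ 'd) measure"
  let ?P = "cube_points {1..n} :: (nat \<Rightarrow> real ^ 'd) measure"
  let ?P' = "cube_points {1..Suc n} :: (nat \<Rightarrow> real ^ 'd) measure"
  define W where "W m u = gap_length \<alpha> u m - compensator \<alpha> u m" for m and u :: "nat \<Rightarrow> real ^ 'd"
  have \<alpha>: "0 \<le> \<alpha>" using s by (simp add: \<alpha>_def)
  interpret Q: prob_space ?Q by (rule prob_space_unit_cube_measure)
  interpret P: prob_space ?P by (rule prob_space_cube_points)
  show ?case
  proof (cases "n = 0")
    case True
    then show ?thesis by (simp add: gap_length_def compensator_def)
  next
    case False
    then have n: "1 \<le> n" by simp
    have W_bound: "\<bar>(W m u)\<^sup>2\<bar> \<le> (2 * (real m * sqrt (real CARD('d)) powr \<alpha>))\<^sup>2" for m u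
      unfolding W_def using abs_gap_length_le[OF \<alpha>, of u m] abs_compensator_le[OF \<alpha>, of u m]
      by (intro abs_power2_le) linarith
    have W_meas: "(\<lambda>u. (W m u)\<^sup>2) \<in> borel_measurable (cube_points {1..m})" for m
      unfolding W_def
      by (intro borel_measurable_power borel_measurable_diff borel_measurable_gap_length
          borel_measurable_compensator)
    have inner: "(\<integral>y. (W (Suc n) (u(Suc n := y)))\<^sup>2 \<partial>?Q) \<le> (W n u)\<^sup>2 + mean_gap (2 * \<alpha>) {1..n} u" for u
    proof -
      let ?g = "\<lambda>y. gap {1..n} u y powr \<alpha>"
      let ?h = "\<integral>y. ?g y \<partial>?Q"
      have sq: "(?g y)\<^sup>2 = gap {1..n} u y powr (2 * \<alpha>)" for y
        by (simp add: power2_eq_square powr_add[symmetric])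
      have int: "integrable ?Q ?g" "integrable ?Q (\<lambda>y. (?g y)\<^sup>2)"
        unfolding sq using \<alpha> by (auto intro!: integrable_gap_powr)
      have "W (Suc n) (u(Suc n := y)) = ?g y - (?h - W n u)" for y
        unfolding W_def gap_length_fun_upd[OF n] compensator_fun_upd[OF n] mean_gap_def by simp
      then have "(\<integral>y. (W (Suc n) (u(Suc n := y)))\<^sup>2 \<partial>?Q) = (\<integral>y. (?g y - (?h - W n u))\<^sup>2 \<partial>?Q)"
        by simp
      also have "\<dots> = (\<integral>y. (?g y)\<^sup>2 \<partial>?Q) - 2 * (?h - W n u) * ?h + (?h - W n u)\<^sup>2"
        using int Q.prob_space by (subst power2_diff) (simp add: algebra_simps)
      also have "\<dots> = (W n u)\<^sup>2 + (\<integral>y. (?g y)\<^sup>2 \<partial>?Q) - ?h\<^sup>2"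
        by (simp add: power2_diff power2_eq_square algebra_simps)
      also have "\<dots> \<le> (W n u)\<^sup>2 + mean_gap (2 * \<alpha>) {1..n} u"
        unfolding mean_gap_def sq by simp
      finally show ?thesis .
    qed
    have "(\<integral>u. (W (Suc n) u)\<^sup>2 \<partial>?P') = (\<integral>u. (\<integral>y. (W (Suc n) (u(Suc n := y)))\<^sup>2 \<partial>?Q) \<partial>?P)"
      by (rule integral_cube_points_Suc[OF W_meas W_bound])
    also have "\<dots> \<le> (\<integral>u. (W n u)\<^sup>2 + mean_gap (2 * \<alpha>) {1..n} u \<partial>?P)"
    proof (rule integral_mono_AE')
      have "integrable ?P (\<lambda>u. (W n u)\<^sup>2)"
        by (rule P.integrable_bounded[OF W_meas W_bound])
      moreover have "integrable ?P (\<lambda>u. mean_gap (2 * \<alpha>) {1..n} u)"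
        using \<alpha> by (intro integrable_mean_gap) auto
      ultimately show "integrable ?P (\<lambda>u. (W n u)\<^sup>2 + mean_gap (2 * \<alpha>) {1..n} u)"
        by (rule Bochner_Integration.integrable_add)
      show "AE u in ?P. 0 \<le> (W n u)\<^sup>2 + mean_gap (2 * \<alpha>) {1..n} u"
        using \<alpha> by (intro AE_I2 add_nonneg_nonneg mean_gap_bounds) auto
    qed (use inner in auto)
    also have "\<dots> = (\<integral>u. (W n u)\<^sup>2 \<partial>?P) + (\<integral>u. mean_gap (2 * \<alpha>) {1..n} u \<partial>?P)"
      using \<alpha>
      by (intro Bochner_Integration.integral_add P.integrable_bounded[OF W_meas W_bound]
          integrable_mean_gap) auto
    also have "(\<integral>u. mean_gap (2 * \<alpha>) {1..n} u \<partial>?P)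
        \<le> moment_const CARD('d) * real (Suc n) powr (- 2 * s)"
      using expectation_mean_gap_le[of "{1..n}" "{1..n}" "2 * s", where 'd = 'd] s
      by (simp add: \<alpha>_def mult.left_commute add.commute)
    also have "(\<integral>u. (W n u)\<^sup>2 \<partial>?P) \<le> moment_const CARD('d) * (\<Sum>j\<in>{1..<n}. real (Suc j) powr (- 2 * s))"
      using Suc.IH by (simp add: W_def)
    finally show ?thesis
      using n unfolding W_def by (simp add: atLeastLessThanSuc distrib_left algebra_simps)
  qed
qed

lemma powr_succ_diff:
  fixes x p :: real
  assumes "0 < x"
  obtains \<xi> where "x < \<xi>" "\<xi> < x + 1" "(x + 1) powr p - x powr p = p * \<xi> powr (p - 1)"
proof -
  have "\<exists>\<xi>>x. \<xi> < x + 1 \<and> (x + 1) powr p - x powr p = (x + 1 - x) * (p * \<xi> powr (p - 1))"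
    by (rule MVT2) (use assms in \<open>auto intro!: has_real_derivative_powr\<close>)
  then show ?thesis using that by auto
qed

lemma sum_powr_tail_le:
  assumes s: "0 < s" and i: "1 \<le> i"
  shows "(\<Sum>j\<in>{i..<n}. real j powr (- 1 - s)) \<le> (1 + 1 / s) * real i powr (- s)"
proof (cases "i < n")
  case False
  then show ?thesis using s by simp
next
  case True
  then obtain k where n: "n = Suc (i + k)" using less_imp_Suc_add by blast
  have "(\<Sum>j\<in>{i..<Suc (i + k)}. real j powr (- 1 - s))
      \<le> real i powr (- 1 - s) + (real i powr (- s) - real (i + k) powr (- s)) / s"
  proof (induction k)
    case (Suc k)
    let ?x = "real (i + k)"
    have x: "0 < ?x" using i by simp
    obtain \<xi> where \<xi>: "?x < \<xi>" "\<xi> < ?x + 1" "(?x + 1) powr (- s) - ?x powr (- s) = - s * \<xi> powr (- s - 1)"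
      using powr_succ_diff[OF x] by blast
    have "(?x + 1) powr (- s - 1) \<le> \<xi> powr (- s - 1)"
      using \<xi> x s by (intro powr_mono2') auto
    then have "s * (?x + 1) powr (- s - 1) \<le> ?x powr (- s) - (?x + 1) powr (- s)"
      using \<xi>(3) s by (smt (verit) mult_left_mono mult_minus_left)
    then have "(?x + 1) powr (- 1 - s) \<le> (?x powr (- s) - (?x + 1) powr (- s)) / s"
      using s by (simp add: le_divide_eq mult.commute minus_diff_commute)
    moreover have "(real i powr (- s) - ?x powr (- s)) / s + (?x powr (- s) - (?x + 1) powr (- s)) / s
        = (real i powr (- s) - (?x + 1) powr (- s)) / s"
      by (simp add: add_divide_distrib[symmetric])
    ultimately show ?case using Suc.IH by (simp add: add.commute add.left_commute)
  qed simp
  also have "\<dots> \<le> real i powr (- s) + real i powr (- s) / s"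
    using s i by (intro add_mono powr_mono divide_right_mono) auto
  finally show ?thesis by (simp add: n algebra_simps)
qed

text \<open>Efron--Stein with \<open>g i\<close> the compensator of the sample without the point \<open>i\<close>. Omitting this
  point changes the \<open>j\<close>-th summand by \<open>O(j powr (-1 - s))\<close> in the \<open>L\<^sup>2\<close> norm if \<open>j \<ge> i\<close>, and not
  at all otherwise. By Minkowski's inequality the sum over \<open>j\<close> is \<open>O(i powr (-s))\<close>.\<close>

lemma variance_compensator_le:
  fixes n :: nat
  assumes s: "0 < s" "s \<le> 1 / 2"
  defines "\<alpha> \<equiv> real CARD('d) * s" and "P \<equiv> cube_points {1..n} :: (nat \<Rightarrow> real ^ 'd) measure"
  shows "(\<integral>u. (compensator \<alpha> u n)\<^sup>2 \<partial>P) - (\<integral>u. compensator \<alpha> u n \<partial>P)\<^sup>2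
    \<le> moment_const CARD('d) * (weight_const CARD('d))\<^sup>2 * (1 + 1 / s)\<^sup>2
        * (\<Sum>i\<in>{1..n}. real i powr (- 2 * s))"
proof -
  let ?K = "moment_const CARD('d) * (weight_const CARD('d))\<^sup>2"
  interpret P: prob_space P unfolding P_def by (rule prob_space_cube_points)
  have \<alpha>: "0 \<le> \<alpha>" using s by (simp add: \<alpha>_def)
  have K: "0 \<le> ?K" using moment_const_pos[of "CARD('d)"] by simp
  define g where "g i u = (\<Sum>j\<in>{1..<n}. mean_gap \<alpha> ({1..j} - {i}) u)" for i and u :: "nat \<Rightarrow> real ^ 'd"
  define \<Delta> where "\<Delta> i j u = mean_gap \<alpha> ({1..j} - {i}) u - mean_gap \<alpha> {1..j} u"
    for i j and u :: "nat \<Rightarrow> real ^ 'd"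
  have g_bound: "\<bar>g i u\<bar> \<le> real n * sqrt (real CARD('d)) powr \<alpha>" for i u
  proof -
    have "\<bar>g i u\<bar> \<le> real (card {1..<n}) * sqrt (real CARD('d)) powr \<alpha>"
      unfolding g_def using \<alpha> by (intro abs_sum_le_card) (auto intro!: mean_gap_bounds)
    also have "\<dots> \<le> real n * sqrt (real CARD('d)) powr \<alpha>"
      by (intro mult_right_mono) auto
    finally show ?thesis .
  qed
  have "(\<integral>u. (compensator \<alpha> u n)\<^sup>2 \<partial>P) - (\<integral>u. compensator \<alpha> u n \<partial>P)\<^sup>2
      \<le> (\<Sum>i\<in>{1..n}. \<integral>u. (compensator \<alpha> u n - g i u)\<^sup>2 \<partial>P)"
    unfolding P_def
  proof (rule efron_stein)
    fix i u y assume i: "i \<in> {1..n}"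
    show "g i (u(i := y)) = g i u"
      unfolding g_def by (intro sum.cong refl mean_gap_cong) auto
    show "g i \<in> borel_measurable (cube_points {1..n})"
      unfolding g_def by (intro borel_measurable_sum borel_measurable_mean_gap) auto
  qed (use prob_space_unit_cube_measure borel_measurable_compensator abs_compensator_le[OF \<alpha>] g_bound in auto)
  also have "\<dots> \<le> (\<Sum>i\<in>{1..n}. ?K * (1 + 1 / s)\<^sup>2 * real i powr (- 2 * s))"
  proof (rule sum_mono)
    fix i assume i: "i \<in> {1..n}"
    define b where "b j = real j powr (- 1 - s)" for j
    have b: "0 < b j" if "j \<in> {i..<n}" for j using that i by (simp add: b_def)
    have \<Delta>_meas: "(\<lambda>u. (\<Delta> i j u)\<^sup>2) \<in> borel_measurable P" if "j \<in> {i..<n}" for j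
      unfolding \<Delta>_def P_def using that
      by (intro borel_measurable_power borel_measurable_diff borel_measurable_mean_gap) auto
    have \<Delta>_bound: "\<bar>(\<Delta> i j u)\<^sup>2\<bar> \<le> (sqrt (real CARD('d)) powr \<alpha>)\<^sup>2" for j u
      unfolding \<Delta>_def using mean_gap_bounds[of "{1..j}", OF _ \<alpha>, of u]
        mean_gap_bounds[of "{1..j} - {i}", OF _ \<alpha>, of u]
      by (intro abs_power2_le) auto
    have \<Delta>_int: "integrable P (\<lambda>u. (\<Delta> i j u)\<^sup>2)" if "j \<in> {i..<n}" for j
      using \<Delta>_meas[OF that] \<Delta>_bound by (rule P.integrable_bounded)
    have E\<Delta>: "(\<integral>u. (\<Delta> i j u)\<^sup>2 \<partial>P) \<le> ?K * (b j)\<^sup>2" if j: "j \<in> {i..<n}" for j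
    proof -
      have ij: "insert i ({1..j} - {i}) = {1..j}" "real (card ({1..j} - {i}) + 1) = real j"
        using i j by auto
      have "{1..j} - {i} \<subseteq> {1..n}" "i \<in> {1..n} - ({1..j} - {i})" using i j by auto
      then show ?thesis
        using expectation_mean_gap_insert_diff_power2_le[of "{1..n}" "{1..j} - {i}" i s, where 'd = 'd] s
        unfolding ij by (simp add: \<Delta>_def \<alpha>_def P_def b_def)
    qed
    have eq: "compensator \<alpha> u n - g i u = - (\<Sum>j\<in>{i..<n}. \<Delta> i j u)" for u
    proof -
      have "g i u - compensator \<alpha> u n = (\<Sum>j\<in>{1..<n}. \<Delta> i j u)"
        by (simp add: g_def compensator_def \<Delta>_def sum_subtractf)
      also have "\<dots> = (\<Sum>j\<in>{i..<n}. \<Delta> i j u)"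
        using i by (intro sum.mono_neutral_right) (auto simp: \<Delta>_def)
      finally show ?thesis by simp
    qed
    (* Minkowski's inequality, as Cauchy--Schwarz with the weights b j that bound the norms. *)
    have pw: "(compensator \<alpha> u n - g i u)\<^sup>2 \<le> sum b {i..<n} * (\<Sum>j\<in>{i..<n}. (\<Delta> i j u)\<^sup>2 / b j)" for u
    proof -
      have "(\<Sum>j\<in>{i..<n}. \<Delta> i j u) = (\<Sum>j\<in>{i..<n}. sqrt (b j) * (\<Delta> i j u / sqrt (b j)))"
        by (intro sum.cong refl) (use b in force)
      then have "(compensator \<alpha> u n - g i u)\<^sup>2
          \<le> (\<Sum>j\<in>{i..<n}. (sqrt (b j))\<^sup>2) * (\<Sum>j\<in>{i..<n}. (\<Delta> i j u / sqrt (b j))\<^sup>2)"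
        using Cauchy_Schwarz_ineq_sum[of "\<lambda>j. sqrt (b j)" "\<lambda>j. \<Delta> i j u / sqrt (b j)" "{i..<n}"]
        by (simp add: eq)
      also have "\<dots> = sum b {i..<n} * (\<Sum>j\<in>{i..<n}. (\<Delta> i j u)\<^sup>2 / b j)"
        using b by (intro arg_cong2[where f = "(*)"] sum.cong refl)
          (auto simp: power_divide less_imp_le)
      finally show ?thesis .
    qed
    have "(\<integral>u. (compensator \<alpha> u n - g i u)\<^sup>2 \<partial>P)
        \<le> (\<integral>u. sum b {i..<n} * (\<Sum>j\<in>{i..<n}. (\<Delta> i j u)\<^sup>2 / b j) \<partial>P)"
    proof (rule integral_mono_AE')
      have "0 \<le> sum b {i..<n} * (\<Sum>j\<in>{i..<n}. (\<Delta> i j u)\<^sup>2 / b j)" for u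
        by (rule order.trans[OF zero_le_power2 pw])
      then show "AE u in P. 0 \<le> sum b {i..<n} * (\<Sum>j\<in>{i..<n}. (\<Delta> i j u)\<^sup>2 / b j)" by simp
    qed (use pw \<Delta>_int in \<open>auto intro!: integrable_mult_right\<close>)
    also have "\<dots> = sum b {i..<n} * (\<Sum>j\<in>{i..<n}. (\<integral>u. (\<Delta> i j u)\<^sup>2 \<partial>P) / b j)"
      using \<Delta>_int by (simp add: Bochner_Integration.integral_sum)
    also have "\<dots> \<le> sum b {i..<n} * (\<Sum>j\<in>{i..<n}. ?K * (b j)\<^sup>2 / b j)"
      using b E\<Delta> by (intro mult_left_mono sum_mono divide_right_mono sum_nonneg) (auto simp: less_imp_le)
    also have "(\<Sum>j\<in>{i..<n}. ?K * (b j)\<^sup>2 / b j) = ?K * sum b {i..<n}"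
      unfolding sum_distrib_left using b by (intro sum.cong refl) (simp add: power2_eq_square)
    also have "sum b {i..<n} * (?K * sum b {i..<n}) = ?K * (sum b {i..<n})\<^sup>2"
      by (simp add: power2_eq_square)
    also have "\<dots> \<le> ?K * ((1 + 1 / s) * real i powr (- s))\<^sup>2"
      using sum_powr_tail_le[OF s(1), of i n] i b
      by (intro mult_left_mono[OF _ K] power_mono sum_nonneg) (auto simp: b_def)
    also have "\<dots> = ?K * (1 + 1 / s)\<^sup>2 * real i powr (- 2 * s)"
      by (simp add: power_mult_distrib power2_eq_square powr_add[symmetric])
    finally show "(\<integral>u. (compensator \<alpha> u n - g i u)\<^sup>2 \<partial>P) \<le> ?K * (1 + 1 / s)\<^sup>2 * real i powr (- 2 * s)" .
  qed
  finally show ?thesis by (simp add: sum_distrib_left)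
qed

definition variance_const :: "nat \<Rightarrow> real \<Rightarrow> real" where
  "variance_const d s = 2 * moment_const d * (1 + (weight_const d)\<^sup>2 * (1 + 1 / s)\<^sup>2)"

lemma variance_gap_length_le:
  fixes n :: nat
  assumes s: "0 < s" "s \<le> 1 / 2"
  defines "\<alpha> \<equiv> real CARD('d) * s" and "P \<equiv> cube_points {1..n} :: (nat \<Rightarrow> real ^ 'd) measure"
  shows "(\<integral>u. (gap_length \<alpha> u n - mean_length TYPE('d) \<alpha> n)\<^sup>2 \<partial>P)
    \<le> variance_const CARD('d) s * (\<Sum>i\<in>{1..n}. real i powr (- 2 * s))"
proof -
  let ?c = "moment_const CARD('d)" and ?S = "\<Sum>i\<in>{1..n}. real i powr (- 2 * s)"
  let ?L = "\<lambda>u. gap_length \<alpha> u n" and ?A = "\<lambda>u. compensator \<alpha> u n"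
  interpret P: prob_space P unfolding P_def by (rule prob_space_cube_points)
  have \<alpha>: "0 \<le> \<alpha>" using s by (simp add: \<alpha>_def)
  have c: "0 < ?c" by (simp add: moment_const_pos)
  define a where "a = (\<integral>u. ?A u \<partial>P)"
  note [measurable] = borel_measurable_gap_length[of \<alpha> n, where 'd = 'd, folded P_def]
    borel_measurable_compensator[of \<alpha> n, where 'd = 'd, folded P_def]
  have A_int: "integrable P ?A" "integrable P (\<lambda>u. (?A u)\<^sup>2)"
    using abs_compensator_le[OF \<alpha>] abs_power2_le[OF abs_compensator_le[OF \<alpha>]]
    by (auto intro!: P.integrable_bounded)
  have W_bound: "\<bar>(?L u - ?A u)\<^sup>2\<bar> \<le> (2 * (real n * sqrt (real CARD('d)) powr \<alpha>))\<^sup>2"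
    for u :: "nat \<Rightarrow> real ^ 'd"
    using abs_gap_length_le[OF \<alpha>, of u n] abs_compensator_le[OF \<alpha>, of u n]
    by (intro abs_power2_le) linarith
  have W_int: "integrable P (\<lambda>u. (?L u - ?A u)\<^sup>2)"
    using W_bound by (intro P.integrable_bounded) auto
  have Aa_int: "integrable P (\<lambda>u. (?A u - a)\<^sup>2)"
    unfolding power2_diff using A_int by simp
  have "(\<integral>u. (?L u - mean_length TYPE('d) \<alpha> n)\<^sup>2 \<partial>P) \<le> (\<integral>u. (?L u - a)\<^sup>2 \<partial>P)"
    using integrable_gap_length[OF \<alpha>, of n, where 'd = 'd]
    unfolding mean_length_def P_def[symmetric] by (intro P.variance_le_expectation_diff_power2)
  also have "\<dots> \<le> (\<integral>u. 2 * (?L u - ?A u)\<^sup>2 + 2 * (?A u - a)\<^sup>2 \<partial>P)"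
  proof (rule integral_mono_AE')
    have "(?L u - a)\<^sup>2 \<le> 2 * (?L u - ?A u)\<^sup>2 + 2 * (?A u - a)\<^sup>2" for u :: "nat \<Rightarrow> real ^ 'd"
    proof -
      from power2_add_le[of "?L u - ?A u" "?A u - a"] show ?thesis by simp
    qed
    then show "AE u in P. (?L u - a)\<^sup>2 \<le> 2 * (?L u - ?A u)\<^sup>2 + 2 * (?A u - a)\<^sup>2" by simp
  qed (use W_int Aa_int in auto)
  also have "\<dots> = 2 * (\<integral>u. (?L u - ?A u)\<^sup>2 \<partial>P) + 2 * (\<integral>u. (?A u - a)\<^sup>2 \<partial>P)"
    using W_int Aa_int by simp
  also have "(\<integral>u. (?A u - a)\<^sup>2 \<partial>P) = (\<integral>u. (?A u)\<^sup>2 \<partial>P) - (\<integral>u. ?A u \<partial>P)\<^sup>2"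
    unfolding a_def by (rule P.variance_eq[OF A_int])
  also have "2 * (\<integral>u. (?L u - ?A u)\<^sup>2 \<partial>P) + 2 * ((\<integral>u. (?A u)\<^sup>2 \<partial>P) - (\<integral>u. ?A u \<partial>P)\<^sup>2)
      \<le> 2 * (?c * ?S) + 2 * (?c * (weight_const CARD('d))\<^sup>2 * (1 + 1 / s)\<^sup>2 * ?S)"
  proof (intro add_mono mult_left_mono)
    have "(\<Sum>j\<in>{1..<n}. real (Suc j) powr (- 2 * s)) \<le> (\<Sum>j\<in>{1..<n}. real j powr (- 2 * s))"
      using s by (intro sum_mono powr_mono2') auto
    also have "\<dots> \<le> ?S" by (intro sum_mono2) auto
    finally have "?c * (\<Sum>j\<in>{1..<n}. real (Suc j) powr (- 2 * s)) \<le> ?c * ?S"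
      using c by (intro mult_left_mono) auto
    then show "(\<integral>u. (?L u - ?A u)\<^sup>2 \<partial>P) \<le> ?c * ?S"
      using expectation_compensated_power2_le[of s n, where 'd = 'd] s
      unfolding \<alpha>_def P_def by linarith
    show "(\<integral>u. (?A u)\<^sup>2 \<partial>P) - (\<integral>u. ?A u \<partial>P)\<^sup>2
        \<le> ?c * (weight_const CARD('d))\<^sup>2 * (1 + 1 / s)\<^sup>2 * ?S"
      unfolding \<alpha>_def P_def by (rule variance_compensator_le[OF s])
  qed auto
  also have "\<dots> = variance_const CARD('d) s * ?S"
    unfolding variance_const_def by (simp add: algebra_simps)
  finally show ?thesis .
qed

lemma powr_diff_ge:
  fixes x p :: real
  assumes "0 \<le> x" "0 < p" "p \<le> 1"
  shows "p * (x + 1) powr (p - 1) \<le> (x + 1) powr p - x powr p"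
proof (cases "x = 0")
  case False
  with assms have x: "0 < x" by simp
  obtain \<xi> where \<xi>: "x < \<xi>" "\<xi> < x + 1" "(x + 1) powr p - x powr p = p * \<xi> powr (p - 1)"
    using powr_succ_diff[OF x] by blast
  show ?thesis unfolding \<xi>(3)
    using \<xi> x assms by (intro mult_left_mono powr_mono2') auto
qed (use assms in simp)

lemma sum_powr_le:
  assumes p: "0 < p" "p \<le> 1" and "k \<le> m"
  shows "(\<Sum>j\<in>{k..<m}. real (Suc j) powr (p - 1)) \<le> (real m powr p - real k powr p) / p"
proof -
  have "p * (\<Sum>j\<in>{k..<m}. real (Suc j) powr (p - 1))
      \<le> (\<Sum>j\<in>{k..<m}. real (Suc j) powr p - real j powr p)"
    unfolding sum_distrib_left
  proof (rule sum_mono)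
    fix j
    show "p * real (Suc j) powr (p - 1) \<le> real (Suc j) powr p - real j powr p"
      using powr_diff_ge[of "real j" p] p by (simp add: add.commute)
  qed
  also have "\<dots> = real m powr p - real k powr p"
    using \<open>k \<le> m\<close> by (rule sum_Suc_diff')
  finally show ?thesis using p by (simp add: le_divide_eq mult.commute)
qed

text \<open>The bounds \<open>Suc j powr (-s)\<close> on the increments exceed \<open>m powr (-s)\<close> for small \<open>j\<close>, but as \<open>s\<close> stays
  away from 1, their average over \<open>{k..<m}\<close> is at most \<open>2 * m powr (-s)\<close> for every \<open>k < m\<close>.
  Consequently small values of a Poisson variable need no separate estimate.\<close>

lemma mean_length_lipschitz:
  assumes s: "0 \<le> s" "s \<le> 1 / 2" and m: "1 \<le> m"
  defines "\<mu> \<equiv> mean_length TYPE('d :: finite) (real CARD('d) * s)"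
  shows "\<bar>\<mu> k - \<mu> m\<bar> \<le> 2 * moment_const CARD('d) * \<bar>real k - real m\<bar> * real m powr (- s)"
proof -
  let ?c = "moment_const CARD('d)"
  have c: "0 < ?c" by (simp add: moment_const_pos)
  have incr: "0 \<le> \<mu> (Suc j) - \<mu> j" "\<mu> (Suc j) - \<mu> j \<le> ?c * real (Suc j) powr (- s)" for j
    using mean_length_Suc_diff[of s j, where 'd = 'd] s by (simp_all add: \<mu>_def)
  have tele: "0 \<le> \<mu> b - \<mu> a" "\<mu> b - \<mu> a \<le> ?c * (\<Sum>j\<in>{a..<b}. real (Suc j) powr (- s))"
    if "a \<le> b" for a b
    unfolding sum_Suc_diff'[OF that, of \<mu>, symmetric] sum_distrib_left
    by (intro sum_nonneg incr sum_mono)+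
  show ?thesis
  proof (cases "m \<le> k")
    case True
    have "(\<Sum>j\<in>{m..<k}. real (Suc j) powr (- s)) \<le> (\<Sum>j\<in>{m..<k}. real m powr (- s))"
      using s m by (intro sum_mono powr_mono2') auto
    also have "\<dots> = (real k - real m) * real m powr (- s)"
      using True by simp
    finally have "\<mu> k - \<mu> m \<le> ?c * ((real k - real m) * real m powr (- s))"
      using tele(2)[OF True] c mult_left_mono[of _ _ ?c] by (meson less_imp_le order_trans)
    moreover have "0 \<le> ?c * ((real k - real m) * real m powr (- s))"
      using True c by auto
    moreover have "\<bar>\<mu> k - \<mu> m\<bar> = \<mu> k - \<mu> m" using tele(1)[OF True] by simp
    moreover have "\<bar>real k - real m\<bar> = real k - real m" using True by simp
    ultimately show ?thesis by (simp add: mult.assoc)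
  next
    case False
    then have le: "k \<le> m" by simp
    have p: "1 / 2 \<le> 1 - s" "1 - s \<le> 1" using s by auto
    have diff: "real m powr (1 - s) - real k powr (1 - s) \<le> (real m - real k) * real m powr (- s)"
    proof -
      have "real m powr (1 - s) = real m * real m powr (- s)"
        using m by (simp add: powr_diff powr_minus divide_inverse)
      moreover have "real k * real m powr (- s) \<le> real k powr (1 - s)"
      proof (cases "k = 0")
        case False
        then have "real k * real m powr (- s) \<le> real k * real k powr (- s)"
          using le s by (intro mult_left_mono powr_mono2') auto
        also have "\<dots> = real k powr (1 - s)"
          using False by (simp add: powr_diff powr_minus divide_inverse)
        finally show ?thesis .
      qed simp
      ultimately show ?thesis by (simp add: left_diff_distrib)
    qed
    have "(\<Sum>j\<in>{k..<m}. real (Suc j) powr (- s)) \<le> (real m powr (1 - s) - real k powr (1 - s)) / (1 - s)"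
      using sum_powr_le[of "1 - s" k m] p le by simp
    also have "\<dots> \<le> ((real m - real k) * real m powr (- s)) / (1 - s)"
      using p by (intro divide_right_mono diff) auto
    also have "\<dots> \<le> ((real m - real k) * real m powr (- s)) / (1 / 2)"
      using p le by (intro divide_left_mono) auto
    finally have "\<mu> m - \<mu> k \<le> ?c * (((real m - real k) * real m powr (- s)) / (1 / 2))"
      using tele(2)[OF le] c mult_left_mono[of _ _ ?c] by (meson less_imp_le order_trans)
    moreover have "\<bar>\<mu> k - \<mu> m\<bar> = \<mu> m - \<mu> k" using tele(1)[OF le] by simp
    moreover have "\<bar>real k - real m\<bar> = real m - real k" using le by simp
    ultimately show ?thesis by (simp add: mult_ac)
  qed
qed

section \<open>The graph on a random sample\<close>

text \<open>A minimum over a fixed index set, from which measurability is evident. Where \<open>u k\<close> coincides with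
  \<open>x\<close>, the sum stands for a value that does not affect the minimum unless all points coincide
  with \<open>x\<close>; in that case it is 0, the value of \<open>infdist\<close> for the empty set.\<close>

lemma nn_dist_eq_Min:
  fixes x :: "real ^ 'd"
  assumes K: "finite K" "K \<noteq> {}"
  shows "nn_dist x (u ` K)
    = Min ((\<lambda>k. if u k = x then \<Sum>j\<in>K. dist x (u j) else dist x (u k)) ` K)"
    (is "_ = Min (?f ` K)")
proof (cases "\<forall>k\<in>K. u k = x")
  case True
  then have "u ` K - {x} = {}" by auto
  moreover have "?f ` K = {0}" using True K by auto
  ultimately show ?thesis by (simp only: nn_dist_def infdist_def) simp
next
  case False
  let ?A = "u ` K - {x}"
  have A: "finite ?A" "?A \<noteq> {}" using False K by auto
  have "nn_dist x (u ` K) = Min (dist x ` ?A)"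
    unfolding nn_dist_def infdist_notempty[OF A(2)] using A by (intro cInf_eq_Min) auto
  also have "\<dots> = Min (?f ` K)"
  proof (rule antisym)
    show "Min (?f ` K) \<le> Min (dist x ` ?A)"
    proof (rule Min.boundedI)
      fix v assume "v \<in> dist x ` ?A"
      then obtain k where "k \<in> K" "u k \<noteq> x" "v = dist x (u k)" by blast
      then have "v \<in> ?f ` K" by auto
      then show "Min (?f ` K) \<le> v" using K by (intro Min_le) auto
    qed (use A in auto)
    show "Min (dist x ` ?A) \<le> Min (?f ` K)"
    proof (rule Min.boundedI)
      fix v assume "v \<in> ?f ` K"
      then obtain k where k: "k \<in> K" "v = ?f k" by blast
      obtain j where j: "j \<in> K" "u j \<noteq> x" using False by blast
      have "Min (dist x ` ?A) \<le> dist x (u j)" using A j by (intro Min_le) auto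
      also have "\<dots> \<le> (\<Sum>j\<in>K. dist x (u j))" using K j by (intro member_le_sum) auto
      finally have 1: "Min (dist x ` ?A) \<le> (\<Sum>j\<in>K. dist x (u j))" .
      show "Min (dist x ` ?A) \<le> v"
      proof (cases "u k = x")
        case True
        then show ?thesis using 1 k by simp
      next
        case False
        then show ?thesis using A k by (auto intro!: Min_le)
      qed
    qed (use K in auto)
  qed
  finally show ?thesis .
qed

lemma borel_measurable_nn_dist:
  fixes u :: "'a \<Rightarrow> 'i \<Rightarrow> real ^ 'd"
  assumes K: "finite K" "K \<noteq> {}"
    and [measurable]: "\<And>k. k \<in> K \<Longrightarrow> (\<lambda>x. u x k) \<in> borel_measurable X" "g \<in> borel_measurable X"
  shows "(\<lambda>x. nn_dist (g x) (u x ` K)) \<in> borel_measurable X"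
  unfolding nn_dist_eq_Min[OF K]
proof (rule borel_measurable_Min[OF K(1)])
  fix k assume [simp]: "k \<in> K"
  show "(\<lambda>x. if u x k = g x then \<Sum>j\<in>K. dist (g x) (u x j) else dist (g x) (u x k))
      \<in> borel_measurable X"
    by measurable
qed

lemma borel_measurable_onng_length:
  fixes u :: "'a \<Rightarrow> nat \<Rightarrow> real ^ 'd"
  assumes "\<And>k. 1 \<le> k \<Longrightarrow> (\<lambda>x. u x k) \<in> borel_measurable X"
  shows "(\<lambda>x. onng_length \<alpha> (u x) n) \<in> borel_measurable X"
  unfolding onng_length_def
  by (intro borel_measurable_sum powr_real_measurable borel_measurable_nn_dist) (auto intro: assms)

text \<open>For distinct points in the cube, neither the cap in the definition of \<open>gap\<close> nor
  the removal of \<open>x\<close> in the definition of \<open>nn_dist\<close> has an effect.\<close>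

lemma nn_dist_eq_gap:
  fixes x :: "real ^ 'd"
  assumes K: "finite K" "K \<noteq> {}" and "x \<notin> u ` K" "x \<in> open_unit_cube" "u ` K \<subseteq> open_unit_cube"
  shows "nn_dist x (u ` K) = gap K u x"
proof -
  have "nn_dist x (u ` K) = Min ((\<lambda>k. dist x (u k)) ` K)"
    unfolding nn_dist_eq_Min[OF K] using assms(3)
    by (intro arg_cong[where f = Min] image_cong) auto
  moreover have "Min ((\<lambda>k. dist x (u k)) ` K) \<le> sqrt (real CARD('d))"
  proof -
    obtain k where k: "k \<in> K" using K by blast
    then have "Min ((\<lambda>k. dist x (u k)) ` K) \<le> dist x (u k)" using K by simp
    also have "\<dots> \<le> sqrt (real CARD('d))"
      using assms k by (intro dist_open_unit_cube_le) auto
    finally show ?thesis .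
  qed
  ultimately show ?thesis using K by (simp add: gap_def)
qed

lemma onng_length_eq_gap_length:
  fixes u :: "nat \<Rightarrow> real ^ 'd"
  assumes cube: "\<And>i. i \<in> {1..n} \<Longrightarrow> u i \<in> open_unit_cube"
    and neq: "\<And>i j. 1 \<le> i \<Longrightarrow> i < j \<Longrightarrow> j \<le> n \<Longrightarrow> u i \<noteq> u j"
  shows "onng_length \<alpha> u n = gap_length \<alpha> u n"
proof -
  have "onng_length \<alpha> u n = (\<Sum>i\<in>{Suc 1..<Suc n}. nn_dist (u i) (u ` {1..<i}) powr \<alpha>)"
    unfolding onng_length_def by (intro sum.cong) auto
  also have "\<dots> = (\<Sum>j\<in>{1..<n}. nn_dist (u (Suc j)) (u ` {1..<Suc j}) powr \<alpha>)"
    by (rule sum.shift_bounds_Suc_ivl)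
  also have "\<dots> = gap_length \<alpha> u n"
    unfolding gap_length_def
  proof (intro sum.cong refl arg_cong[where f = "\<lambda>x. x powr \<alpha>"])
    fix j assume j: "j \<in> {1..<n}"
    have "u i \<noteq> u (Suc j)" if "i \<in> {1..j}" for i
      using that j by (intro neq) auto
    then have "u (Suc j) \<notin> u ` {1..j}" by (metis imageE)
    moreover have "u (Suc j) \<in> open_unit_cube" "u ` {1..j} \<subseteq> open_unit_cube"
      using j by (auto intro!: cube)
    ultimately have "nn_dist (u (Suc j)) (u ` {1..j}) = gap {1..j} u (u (Suc j))"
      using j by (intro nn_dist_eq_gap) auto
    moreover have "{1..<Suc j} = {1..j}" by auto
    ultimately show "nn_dist (u (Suc j)) (u ` {1..<Suc j}) = gap {1..j} u (u (Suc j))" by simp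
  qed
  finally show ?thesis .
qed

lemma gap_length_cong:
  assumes "\<And>i. i \<in> {1..n} \<Longrightarrow> u i = v i"
  shows "gap_length \<alpha> u n = gap_length \<alpha> v n"
  unfolding gap_length_def
proof (intro sum.cong refl arg_cong[where f = "\<lambda>x. x powr \<alpha>"])
  fix j assume j: "j \<in> {1..<n}"
  have "u (Suc j) = v (Suc j)" using j by (intro assms) auto
  then show "gap {1..j} u (u (Suc j)) = gap {1..j} v (v (Suc j))"
    using j by (auto intro!: gap_cong assms)
qed

lemma AE_cube_points_neq:
  assumes "finite I" "i \<in> I" "j \<in> I" "i \<noteq> j"
  shows "AE u in (cube_points I :: ('i \<Rightarrow> real ^ 'd) measure). u i \<noteq> u j"
proof -
  let ?Q = "unit_cube_measure :: (real ^ 'd) measure"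
  let ?P = "cube_points I :: ('i \<Rightarrow> real ^ 'd) measure"
  interpret Q: prob_space ?Q by (rule prob_space_unit_cube_measure)
  interpret product_sigma_finite "\<lambda>_ :: 'i. ?Q" by standard
  have I: "I = insert j (I - {j})" using assms by auto
  have [measurable]: "(\<lambda>u. u i) \<in> borel_measurable ?P" "(\<lambda>u. u j) \<in> borel_measurable ?P"
    using assms by (auto intro!: measurable_component_singleton)
  have meas: "(\<lambda>u. indicator {u. u i = u j} u :: ennreal) \<in> borel_measurable ?P"
    by (rule borel_measurable_indicator') (unfold mem_Collect_eq, measurable)
  have "(\<integral>\<^sup>+u. indicator {u. u i = u j} u \<partial>?P)
      = (\<integral>\<^sup>+u. (\<integral>\<^sup>+y. indicator {u. u i = u j} (u(j := y)) \<partial>?Q) \<partial>cube_points (I - {j}))"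
    using product_nn_integral_insert[of "I - {j}" j "indicator {u. u i = u j}"] meas assms I by simp
  also have "\<dots> = (\<integral>\<^sup>+u. 0 \<partial>(cube_points (I - {j}) :: ('i \<Rightarrow> real ^ 'd) measure))"
  proof (rule nn_integral_cong)
    fix u :: "'i \<Rightarrow> real ^ 'd"
    have "(\<integral>\<^sup>+y. indicator {u. u i = u j} (u(j := y)) \<partial>?Q) = (\<integral>\<^sup>+y. indicator {u i} y \<partial>?Q)"
      using assms by (intro nn_integral_cong) (auto simp: indicator_def)
    also have "\<dots> = 0"
      using AE_unit_cube_measure_neq[of "u i"]
      by (subst nn_integral_0_iff_AE) (auto elim: eventually_mono intro!: borel_measurable_indicator)
    finally show "(\<integral>\<^sup>+y. indicator {u. u i = u j} (u(j := y)) \<partial>?Q) = 0" .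
  qed
  finally have "(\<integral>\<^sup>+u. indicator {u. u i = u j} u \<partial>?P) = 0" by simp
  then have "AE u in ?P. indicator {u. u i = u j} u = (0 :: ennreal)"
    using meas by (subst (asm) nn_integral_0_iff_AE) auto
  then show ?thesis by (rule eventually_mono) (simp add: indicator_def split: if_splits)
qed

locale uniform_sample = prob_space M for M :: "'w measure" +
  fixes U :: "nat \<Rightarrow> 'w \<Rightarrow> real ^ 'd"
  assumes indep: "indep_vars (\<lambda>_. borel) U {1..}"
    and distr_U: "\<And>i. 1 \<le> i \<Longrightarrow> distr M borel (U i) = unit_cube_measure"
begin

lemma measurable_U: "1 \<le> i \<Longrightarrow> U i \<in> borel_measurable M"
  using indep by (auto simp: indep_vars_def)

definition sample_length :: "real \<Rightarrow> nat \<Rightarrow> 'w \<Rightarrow> real" where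
  "sample_length \<alpha> n \<omega> = onng_length \<alpha> (\<lambda>i. U i \<omega>) n"

lemma borel_measurable_sample_length [measurable]: "sample_length \<alpha> n \<in> borel_measurable M"
  unfolding sample_length_def[abs_def]
  by (rule borel_measurable_onng_length) (rule measurable_U)

lemma distr_points:
  assumes "1 \<le> n"
  shows "distr M (cube_points {1..n}) (\<lambda>\<omega>. \<lambda>i\<in>{1..n}. U i \<omega>) = cube_points {1..n}"
proof -
  have "indep_vars (\<lambda>_. borel) U {1..n}"
    by (rule indep_vars_subset[OF indep]) auto
  then have "distr M (\<Pi>\<^sub>M i\<in>{1..n}. borel) (\<lambda>\<omega>. \<lambda>i\<in>{1..n}. U i \<omega>) = (\<Pi>\<^sub>M i\<in>{1..n}. distr M borel (U i))"
    using assms by (subst (asm) indep_vars_iff_distr_eq_PiM') (auto intro: measurable_U)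
  also have "\<dots> = cube_points {1..n}"
    by (intro PiM_cong) (auto simp: distr_U)
  also have "distr M (\<Pi>\<^sub>M i\<in>{1..n}. borel) (\<lambda>\<omega>. \<lambda>i\<in>{1..n}. U i \<omega>)
      = distr M (cube_points {1..n}) (\<lambda>\<omega>. \<lambda>i\<in>{1..n}. U i \<omega>)"
    by (intro distr_cong sets_PiM_cong) auto
  finally show ?thesis .
qed

lemma measurable_points: "(\<lambda>\<omega>. \<lambda>i\<in>{1..n}. U i \<omega>) \<in> measurable M (cube_points {1..n})"
  by (rule measurable_restrict) (auto intro: measurable_U simp: measurable_cong_sets[OF refl sets_unit_cube_measure])

lemma AE_sample_length: "AE \<omega> in M. sample_length \<alpha> n \<omega> = gap_length \<alpha> (\<lambda>i\<in>{1..n}. U i \<omega>) n"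
proof -
  have cube: "AE \<omega> in M. \<forall>i\<in>{1..n}. U i \<omega> \<in> open_unit_cube"
  proof (rule AE_finite_allI)
    fix i assume i: "i \<in> {1..n}"
    then have "AE x in distr M borel (U i). x \<in> open_unit_cube"
      using AE_unit_cube_measure by (subst distr_U) auto
    then show "AE \<omega> in M. U i \<omega> \<in> open_unit_cube"
      using i by (intro AE_distrD[of "U i" M borel]) (auto intro: measurable_U)
  qed simp
  have neq: "AE \<omega> in M. \<forall>p\<in>{(i, j). i \<in> {1..n} \<and> j \<in> {1..n} \<and> i \<noteq> j}. U (fst p) \<omega> \<noteq> U (snd p) \<omega>"
  proof (rule AE_finite_allI)
    show "finite {(i, j). i \<in> {1..n} \<and> j \<in> {1..n} \<and> i \<noteq> j}"
      by (rule finite_subset[of _ "{1..n} \<times> {1..n}"]) auto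
    fix p assume p: "p \<in> {(i, j). i \<in> {1..n} \<and> j \<in> {1..n} \<and> i \<noteq> j}"
    then have n: "1 \<le> n" by auto
    have "AE u in distr M (cube_points {1..n}) (\<lambda>\<omega>. \<lambda>i\<in>{1..n}. U i \<omega>). u (fst p) \<noteq> u (snd p)"
      unfolding distr_points[OF n] using p by (intro AE_cube_points_neq) auto
    from AE_distrD[OF measurable_points this]
    show "AE \<omega> in M. U (fst p) \<omega> \<noteq> U (snd p) \<omega>"
      using p by (auto elim!: eventually_mono)
  qed
  from cube neq show ?thesis
  proof eventually_elim
    case (elim \<omega>)
    have "U i \<omega> \<noteq> U j \<omega>" if "1 \<le> i" "i < j" "j \<le> n" for i j
      using elim(2)[rule_format, of "(i, j)"] that by simp
    then have "onng_length \<alpha> (\<lambda>i. U i \<omega>) n = gap_length \<alpha> (\<lambda>i. U i \<omega>) n"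
      using elim(1) by (intro onng_length_eq_gap_length) auto
    then show ?case
      using gap_length_cong[of n "\<lambda>i. U i \<omega>" "\<lambda>i\<in>{1..n}. U i \<omega>" \<alpha>] by (simp add: sample_length_def)
  qed
qed

lemma integral_sample_length:
  fixes h :: "real \<Rightarrow> real"
  assumes n: "1 \<le> n" and h: "h \<in> borel_measurable borel"
  shows "expectation (\<lambda>\<omega>. h (sample_length \<alpha> n \<omega>)) = (\<integral>u. h (gap_length \<alpha> u n) \<partial>(cube_points {1..n} :: (nat \<Rightarrow> real ^ 'd) measure))"
    and "integrable M (\<lambda>\<omega>. h (sample_length \<alpha> n \<omega>))
      \<longleftrightarrow> integrable (cube_points {1..n} :: (nat \<Rightarrow> real ^ 'd) measure) (\<lambda>u. h (gap_length \<alpha> u n))"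
proof -
  let ?X = "\<lambda>\<omega>. \<lambda>i\<in>{1..n}. U i \<omega>"
  have m: "(\<lambda>u. h (gap_length \<alpha> u n)) \<in> borel_measurable (cube_points {1..n} :: (nat \<Rightarrow> real ^ 'd) measure)"
    by (rule measurable_compose[OF borel_measurable_gap_length h])
  have m1: "(\<lambda>\<omega>. h (sample_length \<alpha> n \<omega>)) \<in> borel_measurable M"
    by (rule measurable_compose[OF borel_measurable_sample_length h])
  have m2: "(\<lambda>\<omega>. h (gap_length \<alpha> (?X \<omega>) n)) \<in> borel_measurable M"
    by (rule measurable_compose[OF measurable_points m])
  have ae: "AE \<omega> in M. h (sample_length \<alpha> n \<omega>) = h (gap_length \<alpha> (?X \<omega>) n)"
    using AE_sample_length[of \<alpha> n] by (rule eventually_mono) simp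
  show "expectation (\<lambda>\<omega>. h (sample_length \<alpha> n \<omega>)) = (\<integral>u. h (gap_length \<alpha> u n) \<partial>(cube_points {1..n} :: (nat \<Rightarrow> real ^ 'd) measure))"
    using integral_distr[OF measurable_points m] distr_points[OF n] integral_cong_AE[OF m1 m2 ae]
    by simp
  show "integrable M (\<lambda>\<omega>. h (sample_length \<alpha> n \<omega>))
      \<longleftrightarrow> integrable (cube_points {1..n} :: (nat \<Rightarrow> real ^ 'd) measure) (\<lambda>u. h (gap_length \<alpha> u n))"
    using integrable_distr_eq[OF measurable_points m] distr_points[OF n] integrable_cong_AE[OF m1 m2 ae]
    by simp
qed

lemma sample_length_0: "sample_length \<alpha> 0 = (\<lambda>_. 0)"
  by (simp add: sample_length_def[abs_def] onng_length_def)

lemma integrable_sample_length: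
  assumes "0 \<le> \<alpha>"
  shows "integrable M (sample_length \<alpha> n)" "integrable M (\<lambda>\<omega>. (sample_length \<alpha> n \<omega>)\<^sup>2)"
proof -
  have "integrable M (sample_length \<alpha> n) \<and> integrable M (\<lambda>\<omega>. (sample_length \<alpha> n \<omega>)\<^sup>2)"
  proof (cases "n = 0")
    case True
    then show ?thesis by (simp add: sample_length_0)
  next
    case False
    then have n: "1 \<le> n" by simp
    show ?thesis
      using integral_sample_length(2)[OF n, of "\<lambda>x. x" \<alpha>] integral_sample_length(2)[OF n, of "\<lambda>x. x\<^sup>2" \<alpha>]
        integrable_gap_length[OF assms, of n, where 'd = 'd] by simp
  qed
  then show "integrable M (sample_length \<alpha> n)" "integrable M (\<lambda>\<omega>. (sample_length \<alpha> n \<omega>)\<^sup>2)" by auto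
qed

lemma expectation_sample_length: "expectation (sample_length \<alpha> n) = mean_length TYPE('d) \<alpha> n"
proof (cases "n = 0")
  case True
  then show ?thesis by (simp add: sample_length_0 mean_length_def gap_length_def)
next
  case False
  then show ?thesis
    using integral_sample_length(1)[of n "\<lambda>x. x" \<alpha>] by (simp add: mean_length_def)
qed

lemma variance_sample_length_le:
  assumes s: "0 < s" "s \<le> 1 / 2"
  shows "variance (sample_length (real CARD('d) * s) n)
    \<le> variance_const CARD('d) s * (\<Sum>i\<in>{1..n}. real i powr (- 2 * s))"
proof (cases "n = 0")
  case True
  then show ?thesis by (simp add: sample_length_0)
next
  case False
  let ?\<alpha> = "real CARD('d) * s"
  have "variance (sample_length ?\<alpha> n)
      = (\<integral>u. (gap_length ?\<alpha> u n - mean_length TYPE('d) ?\<alpha> n)\<^sup>2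
          \<partial>(cube_points {1..n} :: (nat \<Rightarrow> real ^ 'd) measure))"
    unfolding expectation_sample_length
    using False by (intro integral_sample_length(1)[where h = "\<lambda>x. (x - mean_length TYPE('d) ?\<alpha> n)\<^sup>2"]) auto
  also have "\<dots> \<le> variance_const CARD('d) s * (\<Sum>i\<in>{1..n}. real i powr (- 2 * s))"
    by (rule variance_gap_length_le[OF s])
  finally show ?thesis .
qed

lemma expectation_power2_sample_length_diff:
  assumes "0 \<le> \<alpha>"
  shows "expectation (\<lambda>\<omega>. (sample_length \<alpha> n \<omega> - c)\<^sup>2)
    = variance (sample_length \<alpha> n) + (mean_length TYPE('d) \<alpha> n - c)\<^sup>2"
proof -
  note int = integrable_sample_length[OF assms, of n]
  have "expectation (\<lambda>\<omega>. (sample_length \<alpha> n \<omega> - c)\<^sup>2)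
      = expectation (\<lambda>\<omega>. (sample_length \<alpha> n \<omega>)\<^sup>2) - 2 * c * expectation (sample_length \<alpha> n) + c\<^sup>2"
    using int by (simp add: power2_diff prob_space)
  also have "\<dots> = variance (sample_length \<alpha> n) + (expectation (sample_length \<alpha> n) - c)\<^sup>2"
    unfolding variance_eq[OF int] by (simp add: power2_diff)
  finally show ?thesis by (simp add: expectation_sample_length)
qed

end

section \<open>A Poisson number of points\<close>

lemma (in prob_space) variance_le_centred:
  assumes X: "integrable M X" "integrable M (\<lambda>\<omega>. (X \<omega>)\<^sup>2)" and le: "variance X \<le> b"
  shows "variance_le M (centred M X) b"
proof -
  have 0: "expectation (centred M X) = 0"
    unfolding centred_def using X by (simp add: prob_space)
  show ?thesis
    unfolding variance_le_def 0
    using X le by (auto simp: centred_def power2_diff[of "X _"])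
qed

text \<open>The random variables \<open>X\<close> and \<open>Y\<close> have different types, but a real function of \<open>X\<close> and the
  indicator of an event of \<open>Y\<close> do not, so the product rule for the expectation of independent
  real random variables applies to these.\<close>

lemma (in prob_space) expectation_indep_event:
  fixes f :: "'b \<Rightarrow> real"
  assumes ind: "indep_rvs M A X B Y" and f: "f \<in> borel_measurable A" and E: "E \<in> sets B"
    and int: "integrable M (\<lambda>\<omega>. f (X \<omega>))"
  shows "expectation (\<lambda>\<omega>. f (X \<omega>) * indicator E (Y \<omega>))
    = expectation (\<lambda>\<omega>. f (X \<omega>)) * measure (distr M B Y) E"
proof -
  have X: "X \<in> measurable M A" and Y: "Y \<in> measurable M B"
    and set: "indep_set {X -` S \<inter> space M | S. S \<in> sets A} {Y -` S \<inter> space M | S. S \<in> sets B}"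
    using ind by (auto simp: indep_rvs_def)
  let ?X = "\<lambda>\<omega>. f (X \<omega>)" and ?Y = "\<lambda>\<omega>. indicator E (Y \<omega>) :: real"
  have fX: "?X \<in> borel_measurable M" by (rule measurable_compose[OF X f])
  have EY: "?Y \<in> borel_measurable M"
    by (rule measurable_compose[OF Y]) (use E in simp)
  let ?F = "{?X -` S \<inter> space M | S. S \<in> sets borel}" and ?G = "{?Y -` S \<inter> space M | S. S \<in> sets borel}"
  have F: "?F \<subseteq> {X -` S \<inter> space M | S. S \<in> sets A}"
  proof
    fix T assume "T \<in> ?F"
    then obtain S where S: "S \<in> sets borel" "T = ?X -` S \<inter> space M" by blast
    then have "T = X -` (f -` S \<inter> space A) \<inter> space M"
      using measurable_space[OF X] by auto
    then show "T \<in> {X -` S \<inter> space M | S. S \<in> sets A}"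
      using measurable_sets[OF f S(1)] by blast
  qed
  have G: "?G \<subseteq> {Y -` S \<inter> space M | S. S \<in> sets B}"
  proof
    fix T assume "T \<in> ?G"
    then obtain S where S: "S \<in> sets borel" "T = ?Y -` S \<inter> space M" by blast
    have "(indicator E :: _ \<Rightarrow> real) \<in> borel_measurable B" using E by simp
    from measurable_sets[OF this S(1)] have "indicator E -` S \<inter> space B \<in> sets B" .
    moreover have "T = Y -` (g -` S \<inter> space B) \<inter> space M"
      if "T = (\<lambda>\<omega>. g (Y \<omega>)) -` S \<inter> space M" for g :: "_ \<Rightarrow> real"
      using that measurable_space[OF Y] by auto
    note this[OF S(2)]
    ultimately show "T \<in> {Y -` S \<inter> space M | S. S \<in> sets B}" by blast
  qed
  have "indep_set ?F ?G"
    unfolding indep_sets2_eq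
  proof (intro conjI ballI)
    show "?F \<subseteq> events" "?G \<subseteq> events"
      using set F G unfolding indep_sets2_eq by (meson subset_trans)+
    show "prob (a \<inter> b) = prob a * prob b" if "a \<in> ?F" "b \<in> ?G" for a b
      by (rule indep_setD[OF set subsetD[OF F that(1)] subsetD[OF G that(2)]])
  qed
  then have "indep_set (sigma_sets (space M) ?F) (sigma_sets (space M) ?G)"
  proof (rule indep_set_sigma_sets)
    have stable: "Int_stable {h -` S \<inter> space M | S. S \<in> sets borel}" for h :: "'a \<Rightarrow> real"
    proof (rule Int_stableI)
      fix a b
      assume "a \<in> {h -` S \<inter> space M | S. S \<in> sets borel}" "b \<in> {h -` S \<inter> space M | S. S \<in> sets borel}"
      then obtain S T where "S \<in> sets borel" "T \<in> sets borel"
        "a = h -` S \<inter> space M" "b = h -` T \<inter> space M" by blast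
      then have "a \<inter> b = h -` (S \<inter> T) \<inter> space M" "S \<inter> T \<in> sets borel" by auto
      then show "a \<inter> b \<in> {h -` S \<inter> space M | S. S \<in> sets borel}" by blast
    qed
    show "Int_stable ?F" by (rule stable)
    show "Int_stable ?G" by (rule stable)
  qed
  then have "indep_var borel ?X borel ?Y"
    unfolding indep_var_eq using fX EY by (intro conjI)
  moreover have "integrable M ?Y"
    using EY by (intro integrable_bounded[where B = 1]) (auto simp: indicator_def)
  ultimately have "expectation (\<lambda>\<omega>. ?X \<omega> * ?Y \<omega>) = expectation ?X * expectation ?Y"
    using int by (intro indep_var_lebesgue_integral)
  also have "expectation ?Y = measure (distr M B Y) E"
    using integral_distr[OF Y, of "indicator E :: _ \<Rightarrow> real"] E
    by simp
  finally show ?thesis .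
qed

lemma poisson_sums:
  fixes l :: real
  assumes l: "0 < l"
  shows "pmf (poisson_pmf l) sums 1"
    and "(\<lambda>k. pmf (poisson_pmf l) k * real k) sums l"
    and "(\<lambda>k. pmf (poisson_pmf l) k * (real k * (real k - 1))) sums l\<^sup>2"
proof -
  let ?p = "pmf (poisson_pmf l)"
  have p: "?p k = l ^ k / fact k * exp (- l)" for k using l by simp
  have step: "?p (Suc k) * real (Suc k) = l * ?p k" for k
  proof -
    have "fact (Suc k) = real (Suc k) * fact k" by simp
    then show ?thesis unfolding p power_Suc by (simp del: of_nat_Suc fact_Suc)
  qed
  have "(\<lambda>k. (l ^ k /\<^sub>R fact k) * exp (- l)) sums (exp l * exp (- l))"
    by (intro sums_mult2 exp_converges)
  then show 0: "?p sums 1"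
    unfolding p[abs_def] by (simp add: exp_minus divide_inverse mult.commute)
  show 1: "(\<lambda>k. ?p k * real k) sums l"
    using sums_mult[OF 0, of l] sums_Suc_iff[of "\<lambda>k. ?p k * real k" l]
    unfolding step by simp
  have step2: "?p (Suc k) * (real (Suc k) * (real (Suc k) - 1)) = l * (?p k * real k)" for k
  proof -
    have "?p (Suc k) * (real (Suc k) * (real (Suc k) - 1)) = (?p (Suc k) * real (Suc k)) * real k"
      by simp
    then show ?thesis unfolding step by simp
  qed
  show "(\<lambda>k. ?p k * (real k * (real k - 1))) sums l\<^sup>2"
    using sums_mult[OF 1, of l] sums_Suc_iff[of "\<lambda>k. ?p k * (real k * (real k - 1))" "l\<^sup>2"]
    unfolding step2 by (simp only: power2_eq_square) simp
qed

lemma nn_integral_poisson_quadratic: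
  fixes l :: real
  assumes l: "0 < l" and "0 \<le> a" "0 \<le> b" "0 \<le> c"
  shows "(\<integral>\<^sup>+k. ennreal (a + b * real k + c * (real k - l)\<^sup>2) \<partial>measure_pmf (poisson_pmf l))
    = ennreal (a + b * l + c * l)"
proof -
  let ?p = "pmf (poisson_pmf l)"
  let ?f = "\<lambda>k. a + b * real k + c * (real k - l)\<^sup>2"
  have f0: "0 \<le> ?f k" for k using assms by simp
  have "(\<lambda>k. (a + c * l\<^sup>2) * ?p k + (b + c - 2 * c * l) * (?p k * real k)
      + c * (?p k * (real k * (real k - 1)))) sums ((a + c * l\<^sup>2) * 1 + (b + c - 2 * c * l) * l + c * l\<^sup>2)"
    by (intro sums_add sums_mult poisson_sums l)
  also have "(\<lambda>k. (a + c * l\<^sup>2) * ?p k + (b + c - 2 * c * l) * (?p k * real k)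
      + c * (?p k * (real k * (real k - 1)))) = (\<lambda>k. ?p k * ?f k)"
    by (rule ext) (simp add: power2_eq_square algebra_simps)
  also have "(a + c * l\<^sup>2) * 1 + (b + c - 2 * c * l) * l + c * l\<^sup>2 = a + b * l + c * l"
    by (simp add: power2_eq_square algebra_simps)
  finally have sums: "(\<lambda>k. ?p k * ?f k) sums (a + b * l + c * l)" .
  have "(\<integral>\<^sup>+k. ennreal (?f k) \<partial>measure_pmf (poisson_pmf l)) = (\<Sum>k. ennreal (?p k * ?f k))"
    unfolding nn_integral_measure_pmf nn_integral_count_space_nat
    using f0 by (intro suminf_cong) (simp add: ennreal_mult'[symmetric])
  also have "\<dots> = ennreal (a + b * l + c * l)"
    by (rule suminf_ennreal_eq[OF _ sums]) (use f0 in simp)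
  finally show ?thesis .
qed

lemma (in prob_space) distr_poisson_process:
  assumes N: "unit_rate_poisson_process M N" and l: "0 < l"
  shows "N l \<in> measurable M (count_space UNIV)"
    and "distr M (count_space UNIV) (N l) = measure_pmf (poisson_pmf l)"
proof -
  have meas: "N t \<in> measurable M (count_space UNIV)" if "0 \<le> t" for t
    using N that by (auto simp: unit_rate_poisson_process_def)
  show Nl: "N l \<in> measurable M (count_space UNIV)" using meas l by simp
  have N0: "AE \<omega> in M. N 0 \<omega> = 0"
    using N by (auto simp: unit_rate_poisson_process_def elim: eventually_mono)
  note [measurable] = Nl meas[of 0, simplified]
  have "distr M (count_space UNIV) (N l) = distr M (count_space UNIV) (\<lambda>\<omega>. N l \<omega> - N 0 \<omega>)"
    by (rule distr_cong_AE) (use N0 in \<open>auto elim: eventually_mono\<close>)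
  also have "\<dots> = measure_pmf (poisson_pmf (l - 0))"
  proof -
    have "\<forall>s\<ge>0. \<forall>t>s. distr M (count_space UNIV) (\<lambda>\<omega>. N t \<omega> - N s \<omega>) = measure_pmf (poisson_pmf (t - s))"
      using N unfolding unit_rate_poisson_process_def by (elim conjE)
    then show ?thesis using l by blast
  qed
  finally show "distr M (count_space UNIV) (N l) = measure_pmf (poisson_pmf l)" by simp
qed

text \<open>The variance is at most the mean square distance to any constant; the constant chosen is the mean
  for \<open>m = \<lceil>l\<rceil>\<close> points. Given \<open>N l = k\<close>, this distance consists of the variance for \<open>k\<close> points and
  the square of the difference of the means for \<open>k\<close> and \<open>m\<close> points. As the means vary by
  \<open>O(l powr (-s))\<close> per point and \<open>N l\<close> has variance \<open>l\<close>, the latter contributes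
  \<open>O(l powr (1 - 2 * s))\<close>. A bound on the variance that is linear in \<open>k\<close> makes everything a quadratic
  polynomial in \<open>N l\<close>.\<close>

lemma (in uniform_sample) variance_le_poissonized:
  fixes N :: "real \<Rightarrow> 'w \<Rightarrow> nat"
  assumes s: "0 < s" "s \<le> 1 / 2" and l: "1 \<le> l"
    and N: "unit_rate_poisson_process M N"
    and indN: "indep_rvs M
           (PiM {1..} (\<lambda>_. borel)) (\<lambda>\<omega>. \<lambda>i\<in>{1..}. U i \<omega>)
           (PiM {0..} (\<lambda>_. count_space UNIV)) (\<lambda>\<omega>. \<lambda>t\<in>{0..}. N t \<omega>)"
    and ab: "0 \<le> a" "0 \<le> b"
    and var: "\<And>k. variance (sample_length (real CARD('d) * s) k) \<le> a + b * real k"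
  shows "variance_le M (centred M (\<lambda>\<omega>. sample_length (real CARD('d) * s) (N l \<omega>) \<omega>))
    (a + b * l + 16 * (moment_const CARD('d))\<^sup>2 * l powr (1 - 2 * s))"
proof -
  let ?\<alpha> = "real CARD('d) * s" and ?c = "moment_const CARD('d)"
  let ?\<mu> = "mean_length TYPE('d) ?\<alpha>" and ?L = "sample_length ?\<alpha>"
  let ?X = "\<lambda>\<omega>. ?L (N l \<omega>) \<omega>"
  define m where "m = nat \<lceil>l\<rceil>"
  have m: "1 \<le> m" "l \<le> real m" "real m \<le> l + 1" using l by (simp_all add: m_def) linarith+
  have l0: "0 < l" using l by simp
  have \<alpha>: "0 \<le> ?\<alpha>" using s by simp
  define e where "e = 8 * ?c\<^sup>2 * l powr (- 2 * s)"
  have e0: "0 \<le> e" by (simp add: e_def)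
  note Nl = distr_poisson_process[OF N l0]
  note [measurable] = Nl(1)
  have [measurable]: "(\<lambda>\<omega>. indicator {k} (N l \<omega>) :: real) \<in> borel_measurable M" for k
    by (rule measurable_compose[OF Nl(1)]) simp
  have L_sq_int: "integrable M (\<lambda>\<omega>. (?L k \<omega> - x)\<^sup>2)" for k x
    unfolding power2_diff using integrable_sample_length[OF \<alpha>, of k] by simp
  have X_meas: "?X \<in> borel_measurable M"
    by (rule measurable_compose_countable[OF _ Nl(1)]) simp
  have second_moment: "expectation (\<lambda>\<omega>. (?L k \<omega> - ?\<mu> m)\<^sup>2) \<le> a + e + b * real k + e * (real k - l)\<^sup>2" for k
  proof -
    have "(?\<mu> k - ?\<mu> m)\<^sup>2 \<le> (2 * ?c * \<bar>real k - real m\<bar> * real m powr (- s))\<^sup>2"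
    proof -
      have "\<bar>?\<mu> k - ?\<mu> m\<bar> \<le> 2 * ?c * \<bar>real k - real m\<bar> * real m powr (- s)"
        using s m by (intro mean_length_lipschitz) auto
      from abs_power2_le[OF this] show ?thesis by simp
    qed
    also have "\<dots> = 4 * ?c\<^sup>2 * real m powr (- 2 * s) * (real k - real m)\<^sup>2"
      by (simp add: power_mult_distrib power2_eq_square[of "_ powr _"] powr_add[symmetric])
    also have "\<dots> \<le> 4 * ?c\<^sup>2 * l powr (- 2 * s) * (2 * (real k - l)\<^sup>2 + 2)"
    proof (intro mult_mono mult_left_mono)
      show "real m powr (- 2 * s) \<le> l powr (- 2 * s)"
        using m l s by (intro powr_mono2') auto
      from power2_add_le[of "real k - l" "l - real m"]
      have "(real k - real m)\<^sup>2 \<le> 2 * (real k - l)\<^sup>2 + 2 * (l - real m)\<^sup>2" by simp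
      moreover have "(l - real m)\<^sup>2 \<le> 1"
        using m by (simp add: abs_square_le_1)
      ultimately show "(real k - real m)\<^sup>2 \<le> 2 * (real k - l)\<^sup>2 + 2" by linarith
    qed auto
    also have "\<dots> = e + e * (real k - l)\<^sup>2"
      by (simp add: e_def algebra_simps)
    finally show ?thesis
      using var[of k] expectation_power2_sample_length_diff[OF \<alpha>, of k "?\<mu> m"] by simp
  qed
  have event: "expectation (\<lambda>\<omega>. (?L k \<omega> - ?\<mu> m)\<^sup>2 * indicator {k} (N l \<omega>))
      = expectation (\<lambda>\<omega>. (?L k \<omega> - ?\<mu> m)\<^sup>2) * pmf (poisson_pmf l) k" for k
  proof -
    let ?A = "PiM {1..} (\<lambda>_. borel) :: (nat \<Rightarrow> real ^ 'd) measure"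
    let ?B = "PiM {0..} (\<lambda>_. count_space UNIV) :: (real \<Rightarrow> nat) measure"
    let ?f = "\<lambda>u. (onng_length ?\<alpha> u k - ?\<mu> m)\<^sup>2"
    let ?U = "\<lambda>\<omega>. \<lambda>i\<in>{1..}. U i \<omega>" and ?N = "\<lambda>\<omega>. \<lambda>t\<in>{0..}. N t \<omega>"
    let ?E = "{t \<in> space ?B. t l = k}"
    have "onng_length ?\<alpha> (?U \<omega>) k = ?L k \<omega>" for \<omega>
      unfolding sample_length_def onng_length_def
      by (intro sum.cong refl arg_cong2[where f = "(powr)"] arg_cong2[where f = nn_dist] image_cong) auto
    then have fU: "?f (?U \<omega>) = (?L k \<omega> - ?\<mu> m)\<^sup>2" for \<omega> by simp
    have "(\<lambda>u. onng_length ?\<alpha> u k) \<in> borel_measurable ?A"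
      by (rule borel_measurable_onng_length) (auto intro!: measurable_component_singleton)
    then have f: "?f \<in> borel_measurable ?A" by simp
    have lB: "(\<lambda>t. t l) \<in> measurable ?B (count_space UNIV)"
      using l0 by (intro measurable_component_singleton) auto
    have E: "?E \<in> sets ?B"
      using measurable_sets[OF lB, of "{k}"] by (simp add: vimage_def Int_def conj_commute)
    have NB: "?N \<in> measurable M ?B" using indN by (simp add: indep_rvs_def)
    have ind_eq: "indicator ?E (?N \<omega>) = (indicator {k} (N l \<omega>) :: real)" if "\<omega> \<in> space M" for \<omega>
      using measurable_space[OF NB that] l0 by (simp add: indicator_def)
    have "measure (distr M ?B ?N) ?E = measure (distr M (count_space UNIV) (N l)) {k}"
    proof -
      have "?N -` ?E \<inter> space M = N l -` {k} \<inter> space M"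
        using measurable_space[OF NB] l0 by auto
      then show ?thesis using NB E Nl(1) by (simp add: measure_distr)
    qed
    also have "\<dots> = pmf (poisson_pmf l) k"
      unfolding Nl(2) by (simp add: pmf.rep_eq)
    finally have PE: "measure (distr M ?B ?N) ?E = pmf (poisson_pmf l) k" .
    have "expectation (\<lambda>\<omega>. (?L k \<omega> - ?\<mu> m)\<^sup>2 * indicator {k} (N l \<omega>))
        = expectation (\<lambda>\<omega>. ?f (?U \<omega>) * indicator ?E (?N \<omega>))"
      by (intro Bochner_Integration.integral_cong refl) (simp only: fU ind_eq)
    also have "\<dots> = expectation (\<lambda>\<omega>. ?f (?U \<omega>)) * measure (distr M ?B ?N) ?E"
      by (rule expectation_indep_event[OF indN f E]) (simp only: fU L_sq_int)
    finally show ?thesis unfolding fU PE .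
  qed
  have "(\<integral>\<^sup>+\<omega>. ennreal ((?X \<omega> - ?\<mu> m)\<^sup>2) \<partial>M)
      = (\<integral>\<^sup>+\<omega>. (\<Sum>k. ennreal ((?L k \<omega> - ?\<mu> m)\<^sup>2 * indicator {k} (N l \<omega>))) \<partial>M)"
  proof (rule nn_integral_cong)
    fix \<omega>
    have "(\<Sum>k. ennreal ((?L k \<omega> - ?\<mu> m)\<^sup>2 * indicator {k} (N l \<omega>)))
        = (\<Sum>k\<in>{N l \<omega>}. ennreal ((?L k \<omega> - ?\<mu> m)\<^sup>2 * indicator {k} (N l \<omega>)))"
      by (rule suminf_finite) auto
    then show "ennreal ((?X \<omega> - ?\<mu> m)\<^sup>2)
        = (\<Sum>k. ennreal ((?L k \<omega> - ?\<mu> m)\<^sup>2 * indicator {k} (N l \<omega>)))" by simp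
  qed
  also have "\<dots> = (\<Sum>k. \<integral>\<^sup>+\<omega>. ennreal ((?L k \<omega> - ?\<mu> m)\<^sup>2 * indicator {k} (N l \<omega>)) \<partial>M)"
    by (rule nn_integral_suminf) measurable
  also have "\<dots> = (\<Sum>k. ennreal (expectation (\<lambda>\<omega>. (?L k \<omega> - ?\<mu> m)\<^sup>2) * pmf (poisson_pmf l) k))"
  proof (rule suminf_cong)
    fix k
    have "integrable M (\<lambda>\<omega>. (?L k \<omega> - ?\<mu> m)\<^sup>2 * indicator {k} (N l \<omega>))"
      by (rule Bochner_Integration.integrable_bound[OF L_sq_int[of k "?\<mu> m"]])
         (measurable, auto simp: indicator_def)
    then show "(\<integral>\<^sup>+\<omega>. ennreal ((?L k \<omega> - ?\<mu> m)\<^sup>2 * indicator {k} (N l \<omega>)) \<partial>M)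
        = ennreal (expectation (\<lambda>\<omega>. (?L k \<omega> - ?\<mu> m)\<^sup>2) * pmf (poisson_pmf l) k)"
      unfolding event[symmetric] by (rule nn_integral_eq_integral) auto
  qed
  also have "\<dots> \<le> (\<Sum>k. ennreal (pmf (poisson_pmf l) k)
      * ennreal (a + e + b * real k + e * (real k - l)\<^sup>2))"
  proof (rule suminf_le)
    fix k
    show "ennreal (expectation (\<lambda>\<omega>. (?L k \<omega> - ?\<mu> m)\<^sup>2) * pmf (poisson_pmf l) k)
        \<le> ennreal (pmf (poisson_pmf l) k) * ennreal (a + e + b * real k + e * (real k - l)\<^sup>2)"
      using mult_right_mono[OF second_moment[of k], of "pmf (poisson_pmf l) k"] ab e0
      by (subst ennreal_mult'[symmetric]) (auto intro!: ennreal_leI simp: mult.commute)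
  qed auto
  also have "\<dots> = (\<integral>\<^sup>+k. ennreal (a + e + b * real k + e * (real k - l)\<^sup>2) \<partial>measure_pmf (poisson_pmf l))"
    by (simp add: nn_integral_measure_pmf nn_integral_count_space_nat)
  also have "\<dots> = ennreal (a + e + b * l + e * l)"
    using ab e0 l0 by (intro nn_integral_poisson_quadratic) auto
  finally have bound: "(\<integral>\<^sup>+\<omega>. ennreal ((?X \<omega> - ?\<mu> m)\<^sup>2) \<partial>M) \<le> ennreal (a + e + b * l + e * l)" .
  have int: "integrable M (\<lambda>\<omega>. (?X \<omega> - ?\<mu> m)\<^sup>2)"
    using X_meas bound by (intro integrableI_bounded) (auto intro: le_less_trans)
  have X_sq: "integrable M (\<lambda>\<omega>. (?X \<omega>)\<^sup>2)"
  proof (rule Bochner_Integration.integrable_bound)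
    show "integrable M (\<lambda>\<omega>. 2 * (?X \<omega> - ?\<mu> m)\<^sup>2 + 2 * (?\<mu> m)\<^sup>2)" using int by simp
    from power2_add_le[of "?X _ - ?\<mu> m" "?\<mu> m"]
    show "AE \<omega> in M. norm ((?X \<omega>)\<^sup>2) \<le> norm (2 * (?X \<omega> - ?\<mu> m)\<^sup>2 + 2 * (?\<mu> m)\<^sup>2)" by simp
  qed (use X_meas in simp)
  have X: "integrable M ?X"
    by (rule square_integrable_imp_integrable[OF X_meas X_sq])
  have "ennreal (expectation (\<lambda>\<omega>. (?X \<omega> - ?\<mu> m)\<^sup>2)) \<le> ennreal (a + e + b * l + e * l)"
    using bound nn_integral_eq_integral[OF int] by simp
  then have "expectation (\<lambda>\<omega>. (?X \<omega> - ?\<mu> m)\<^sup>2) \<le> a + e + b * l + e * l"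
    using ab e0 l0 by (subst (asm) ennreal_le_iff) auto
  also have "\<dots> \<le> a + b * l + 2 * e * l"
    using mult_left_mono[OF l e0] by simp
  also have "2 * e * l = 16 * ?c\<^sup>2 * l powr (1 - 2 * s)"
    using l0 by (simp add: e_def powr_diff powr_minus divide_inverse)
  finally have "variance ?X \<le> a + b * l + 16 * ?c\<^sup>2 * l powr (1 - 2 * s)"
    using variance_le_expectation_diff_power2[OF X X_sq, of "?\<mu> m"] by linarith
  then show ?thesis by (rule variance_le_centred[OF X X_sq])
qed

section \<open>The variance bounds\<close>

lemma sum_inverse_le_ln: "1 \<le> n \<Longrightarrow> (\<Sum>i\<in>{1..n}. real i powr (- 1)) \<le> 1 + ln (real n)"
proof -
  assume n: "1 \<le> n"
  have "(\<Sum>i\<in>{1..n}. real i powr (- 1)) = harm n"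
    unfolding harm_def by (intro sum.cong refl) (simp add: powr_minus)
  also have "\<dots> \<le> 1 + ln (real n)"
    using euler_mascheroni_sequence_decreasing[of 1 n] n by (simp add: harm_def)
  finally show ?thesis .
qed

lemma variance_const_pos: "0 < d \<Longrightarrow> 0 < variance_const d s"
  unfolding variance_const_def using moment_const_pos[of d]
  by (intro mult_pos_pos add_pos_nonneg) auto

context uniform_sample
begin

lemma variance_sample_length_le_powr:
  assumes s: "0 < s" "s < 1 / 2"
  shows "variance (sample_length (real CARD('d) * s) n)
    \<le> variance_const CARD('d) s / (1 - 2 * s) * real n powr (1 - 2 * s)"
proof -
  have "(\<Sum>i\<in>{1..n}. real i powr (- 2 * s)) = (\<Sum>j\<in>{0..<n}. real (Suc j) powr ((1 - 2 * s) - 1))"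
    using sum.shift_bounds_Suc_ivl[of "\<lambda>i. real i powr (- 2 * s)" 0 n]
    by (simp add: atLeastLessThanSuc_atLeastAtMost One_nat_def)
  also have "\<dots> \<le> (real n powr (1 - 2 * s) - real 0 powr (1 - 2 * s)) / (1 - 2 * s)"
    using s by (intro sum_powr_le) auto
  finally have sum: "(\<Sum>i\<in>{1..n}. real i powr (- 2 * s)) \<le> real n powr (1 - 2 * s) / (1 - 2 * s)"
    by simp
  have "variance (sample_length (real CARD('d) * s) n)
      \<le> variance_const CARD('d) s * (\<Sum>i\<in>{1..n}. real i powr (- 2 * s))"
    using s by (intro variance_sample_length_le) auto
  also have "\<dots> \<le> variance_const CARD('d) s * (real n powr (1 - 2 * s) / (1 - 2 * s))"
    using variance_const_pos[of "CARD('d)" s] by (intro mult_left_mono[OF sum]) auto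
  finally show ?thesis by simp
qed

lemma variance_sample_length_le_ln:
  assumes "1 \<le> n"
  shows "variance (sample_length (real CARD('d) * (1 / 2)) n)
    \<le> variance_const CARD('d) (1 / 2) * (1 + ln (real n))"
proof -
  have "variance (sample_length (real CARD('d) * (1 / 2)) n)
      \<le> variance_const CARD('d) (1 / 2) * (\<Sum>i\<in>{1..n}. real i powr (- 2 * (1 / 2)))"
    by (rule variance_sample_length_le) auto
  also have "\<dots> \<le> variance_const CARD('d) (1 / 2) * (1 + ln (real n))"
    using sum_inverse_le_ln[OF assms] variance_const_pos[of "CARD('d)" "1 / 2"]
    by (intro mult_left_mono) auto
  finally show ?thesis .
qed

end

lemma variance_le_mono: "variance_le M X b \<Longrightarrow> b \<le> c \<Longrightarrow> variance_le M X c"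
  by (auto simp: variance_le_def)

theorem theorem2p1:
  fixes M :: "'w measure"
    and U :: "nat \<Rightarrow> 'w \<Rightarrow> real ^ 'd"
    and N :: "real \<Rightarrow> 'w \<Rightarrow> nat"
  assumes "prob_space M"
    and "prob_space.indep_vars M (\<lambda>_. borel) U {1..}"
    and "\<And>i. i \<ge> 1 \<Longrightarrow> distr M borel (U i) = uniform_measure lborel open_unit_cube"
    and "unit_rate_poisson_process M N"
    and "indep_rvs M
           (PiM {1..} (\<lambda>_. borel)) (\<lambda>\<omega>. \<lambda>i\<in>{1..}. U i \<omega>)
           (PiM {0..} (\<lambda>_. count_space UNIV)) (\<lambda>\<omega>. \<lambda>t\<in>{0..}. N t \<omega>)"
  shows
    "(\<forall>\<alpha>. 0 < \<alpha> \<and> \<alpha> < real CARD('d) / 2 \<longrightarrow>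
       (\<exists>C>0. \<forall>(n::nat) (l::real). n \<ge> 1 \<and> l \<ge> 1 \<longrightarrow>
          variance_le M (centred M (\<lambda>\<omega>. onng_length \<alpha> (\<lambda>i. U i \<omega>) n))
            (C * real n powr (1 - 2 * \<alpha> / real CARD('d))) \<and>
          variance_le M (centred M (\<lambda>\<omega>. onng_length \<alpha> (\<lambda>i. U i \<omega>) (N l \<omega>)))
            (C * l powr (1 - 2 * \<alpha> / real CARD('d)))))
     \<and>
     (\<exists>C>0. \<forall>(n::nat) (l::real). n \<ge> 1 \<and> l \<ge> 1 \<longrightarrow>
        variance_le M (centred M (\<lambda>\<omega>. onng_length (real CARD('d) / 2) (\<lambda>i. U i \<omega>) n))
          (C * ln (1 + real n)) \<and>
        variance_le M (centred M (\<lambda>\<omega>. onng_length (real CARD('d) / 2) (\<lambda>i. U i \<omega>) (N l \<omega>)))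
          (C * ln (1 + l)))"
proof -
  interpret prob_space M by fact
  interpret uniform_sample M U
  proof
    show "indep_vars (\<lambda>_. borel) U {1..}" by fact
    show "distr M borel (U i) = unit_cube_measure" if "1 \<le> i" for i
      using assms(3)[OF that] by (simp add: unit_cube_measure_def)
  qed
  let ?d = "CARD('d)"
  let ?c = "16 * (moment_const ?d)\<^sup>2"
  have d: "0 < ?d" by simp
  note c = moment_const_pos[OF d]
  note poisson = variance_le_poissonized[OF _ _ _ assms(4,5)]
  show ?thesis
  proof (intro conjI allI impI)
    fix \<alpha> :: real assume \<alpha>: "0 < \<alpha> \<and> \<alpha> < real ?d / 2"
    define s where "s = \<alpha> / real ?d"
    have s: "0 < s" "s < 1 / 2" and \<alpha>_eq: "\<alpha> = real ?d * s" and s_eq: "1 - 2 * \<alpha> / real ?d = 1 - 2 * s"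
      using \<alpha> by (auto simp: s_def field_simps)
    define K where "K = variance_const ?d s / (1 - 2 * s)"
    have K: "0 < K" using s variance_const_pos[OF d, of s] by (simp add: K_def)
    have var: "variance (sample_length \<alpha> k) \<le> K * real k powr (1 - 2 * s)" for k
      unfolding \<alpha>_eq K_def by (rule variance_sample_length_le_powr[OF s])
    show "\<exists>C>0. \<forall>(n::nat) (l::real). n \<ge> 1 \<and> l \<ge> 1 \<longrightarrow>
        variance_le M (centred M (\<lambda>\<omega>. onng_length \<alpha> (\<lambda>i. U i \<omega>) n))
          (C * real n powr (1 - 2 * \<alpha> / real ?d)) \<and>
        variance_le M (centred M (\<lambda>\<omega>. onng_length \<alpha> (\<lambda>i. U i \<omega>) (N l \<omega>)))
          (C * l powr (1 - 2 * \<alpha> / real ?d))"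
      unfolding s_eq sample_length_def[symmetric]
    proof (intro exI[of _ "2 * K + ?c"] conjI allI impI)
      show "0 < 2 * K + ?c" using K by (intro add_pos_nonneg) auto
    next
      fix n :: nat and l :: real assume nl: "n \<ge> 1 \<and> l \<ge> 1"
      have "variance (sample_length \<alpha> n) \<le> (2 * K + ?c) * real n powr (1 - 2 * s)"
        by (rule order.trans[OF var mult_right_mono]) (use K in auto)
      then show "variance_le M (centred M (\<lambda>\<omega>. sample_length \<alpha> n \<omega>))
          ((2 * K + ?c) * real n powr (1 - 2 * s))"
        using \<alpha> by (intro variance_le_centred integrable_sample_length) auto
      let ?p = "l powr (1 - 2 * s)"
      have l: "0 < l" using nl by simp
      (* x powr q \<le> 1 + x for 0 \<le> q \<le> 1 bounds the power by a function linear in k. *)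
      have lin: "variance (sample_length \<alpha> k) \<le> K * ?p + K * ?p / l * real k" for k
      proof -
        have "(real k / l) powr (1 - 2 * s) \<le> (1 + real k / l) powr (1 - 2 * s)"
          using s l by (intro powr_mono2) auto
        also have "\<dots> \<le> (1 + real k / l) powr 1"
          using s l by (intro powr_mono) auto
        finally have "real k powr (1 - 2 * s) \<le> ?p * (1 + real k / l)"
          using l by (simp add: powr_divide divide_le_eq mult.commute)
        then have "K * real k powr (1 - 2 * s) \<le> K * (?p * (1 + real k / l))"
          using K by (intro mult_left_mono) auto
        also have "\<dots> = K * ?p + K * ?p / l * real k" by (simp add: distrib_left)
        finally show ?thesis using var[of k] by linarith
      qed
      have "variance_le M (centred M (\<lambda>\<omega>. sample_length \<alpha> (N l \<omega>) \<omega>))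
          (K * ?p + K * ?p / l * l + ?c * l powr (1 - 2 * s))"
        unfolding \<alpha>_eq using s nl K l lin[unfolded \<alpha>_eq] by (intro poisson) auto
      moreover have "K * ?p + K * ?p / l * l + ?c * l powr (1 - 2 * s) = (2 * K + ?c) * ?p"
        using l by (simp add: algebra_simps)
      ultimately show "variance_le M (centred M (\<lambda>\<omega>. sample_length \<alpha> (N l \<omega>) \<omega>)) ((2 * K + ?c) * ?p)"
        by simp
    qed
  next
    define \<alpha> where "\<alpha> = real ?d / 2"
    have \<alpha>: "0 \<le> \<alpha>" and \<alpha>_eq: "\<alpha> = real ?d * (1 / 2)" by (simp_all add: \<alpha>_def)
    define K where "K = variance_const ?d (1 / 2)"
    have K: "0 < K" using variance_const_pos[OF d] by (simp add: K_def)
    have var: "variance (sample_length \<alpha> k) \<le> K * (1 + ln (1 + real k))" for k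
    proof (cases "k = 0")
      case True
      then show ?thesis using K by (simp add: sample_length_0)
    next
      case False
      then have "variance (sample_length \<alpha> k) \<le> K * (1 + ln (real k))"
        unfolding \<alpha>_eq K_def by (intro variance_sample_length_le_ln) auto
      also have "\<dots> \<le> K * (1 + ln (1 + real k))"
        using K False by (intro mult_left_mono) auto
      finally show ?thesis .
    qed
    define C where "C = K * (1 + 2 / ln 2) + ?c / ln 2"
    have ln2: "0 < ln (2 :: real)" by simp
    have C: "0 < C" unfolding C_def using K ln2 by (intro add_pos_nonneg mult_pos_pos) auto
    have C_ge: "K * (2 + ln (1 + x)) + ?c \<le> C * ln (1 + x)" if "1 \<le> x" for x :: real
    proof -
      have "1 \<le> ln (1 + x) / ln 2"
        using that ln2 by (simp add: le_divide_eq)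
      then have "K * (2 * 1 + ln (1 + x)) + ?c * 1
          \<le> K * (2 * (ln (1 + x) / ln 2) + ln (1 + x)) + ?c * (ln (1 + x) / ln 2)"
        using K by (intro add_mono mult_left_mono) auto
      also have "\<dots> = C * ln (1 + x)" by (simp add: C_def algebra_simps)
      finally show ?thesis by simp
    qed
    show "\<exists>C>0. \<forall>(n::nat) (l::real). n \<ge> 1 \<and> l \<ge> 1 \<longrightarrow>
        variance_le M (centred M (\<lambda>\<omega>. onng_length (real ?d / 2) (\<lambda>i. U i \<omega>) n))
          (C * ln (1 + real n)) \<and>
        variance_le M (centred M (\<lambda>\<omega>. onng_length (real ?d / 2) (\<lambda>i. U i \<omega>) (N l \<omega>)))
          (C * ln (1 + l))"
      unfolding \<alpha>_def[symmetric] sample_length_def[symmetric]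
    proof (intro exI[of _ C] conjI allI impI C)
      fix n :: nat and l :: real assume nl: "n \<ge> 1 \<and> l \<ge> 1"
      have "K * (1 + ln (1 + real n)) \<le> K * (2 + ln (1 + real n)) + ?c"
      proof -
        have "K * (1 + ln (1 + real n)) \<le> K * (2 + ln (1 + real n))"
          using K by (intro mult_left_mono) auto
        then show ?thesis by (simp add: add_increasing2)
      qed
      also have "\<dots> \<le> C * ln (1 + real n)" using nl by (intro C_ge) auto
      finally have "variance (sample_length \<alpha> n) \<le> C * ln (1 + real n)"
        using var[of n] by linarith
      then show "variance_le M (centred M (\<lambda>\<omega>. sample_length \<alpha> n \<omega>)) (C * ln (1 + real n))"
        by (intro variance_le_centred integrable_sample_length \<alpha>)
      have l: "0 < l" using nl by simp
      (* The tangent of the logarithm at 1 + l. *)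
      have lin: "variance (sample_length \<alpha> k) \<le> K * (1 + ln (1 + l)) + K / l * real k" for k
      proof -
        have "ln (1 + real k) - ln (1 + l) = ln ((1 + real k) / (1 + l))"
          using l by (simp add: ln_div)
        also have "\<dots> \<le> (1 + real k) / (1 + l) - 1"
          using l by (intro ln_le_minus_one) auto
        also have "\<dots> \<le> real k / l"
          using l by (simp add: field_simps)
        finally have "K * (1 + ln (1 + real k)) \<le> K * (1 + ln (1 + l) + real k / l)"
          using K by (intro mult_left_mono) auto
        also have "\<dots> = K * (1 + ln (1 + l)) + K / l * real k" by (simp add: algebra_simps)
        finally show ?thesis using var[of k] by linarith
      qed
      have "variance_le M (centred M (\<lambda>\<omega>. sample_length \<alpha> (N l \<omega>) \<omega>))
          (K * (1 + ln (1 + l)) + K / l * l + ?c * l powr (1 - 2 * (1 / 2)))"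
        unfolding \<alpha>_eq using nl K l lin[unfolded \<alpha>_eq] by (intro poisson) auto
      moreover have "K * (1 + ln (1 + l)) + K / l * l + ?c * l powr (1 - 2 * (1 / 2)) \<le> C * ln (1 + l)"
        using C_ge[of l] nl l by (simp add: algebra_simps)
      ultimately show "variance_le M (centred M (\<lambda>\<omega>. sample_length \<alpha> (N l \<omega>) \<omega>)) (C * ln (1 + l))"
        by (rule variance_le_mono)
    qed
  qed
qed

end
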